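(* Let $p>2$ be a prime and let $G$ be a finite $p$-group of coclass $2$, with $|G|=p^n$. Then $G$ has a noninner automorphism of order $p$. Moreover, when $n\geq 7$, this noninner automorphism of order $p$ leaves either $\Phi(G)$ or $Z_{n-4}(G)$ elementwise fixed (that is, when $n\ge 7$, $G$ has a noninner automorphism of order $p$ that fixes every element of $\Phi(G)$ or fixes every element of $Z_{n-4}(G)$).
   Context: The (nilpotency) coclass of a $p$-group of order $p^n$ is $n-c$, where $c$ is its nilpotency class. $\Phi(G)$ denotes the Frattini subgroup of $G$, and $Z_i(G)$ denotes the $i$-th term of the upper central series of $G$ (so $Z_1(G)=Z(G)$ and $Z_{i+1}(G)/Z_i(G)=Z(G/Z_i(G))$). *)

theory Defs
  imports
    "HOL-Algebra.Bij"
    "HOL-Algebra.Coset"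
    "HOL-Algebra.Multiplicative_Group"
    "HOL-Computational_Algebra.Primes"
begin

definition group_center :: "('a, 'b) monoid_scheme \<Rightarrow> 'a set" where
  "group_center G = {z \<in> carrier G. \<forall>x \<in> carrier G. z \<otimes>\<^bsub>G\<^esub> x = x \<otimes>\<^bsub>G\<^esub> z}"

text \<open>\<open>Z\<^sub>0 = 1\<close>, and \<open>Z\<^sub>i\<^sub>+\<^sub>1\<close> is the full preimage in \<open>G\<close> of the center of \<open>G / Z\<^sub>i\<close>.\<close>

primrec upper_central :: "('a, 'b) monoid_scheme \<Rightarrow> nat \<Rightarrow> 'a set" where
  "upper_central G 0 = {\<one>\<^bsub>G\<^esub>}"
| "upper_central G (Suc i) =
     {x \<in> carrier G. upper_central G i #>\<^bsub>G\<^esub> x \<in> group_center (G Mod upper_central G i)}"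

text \<open>Only meaningful for nilpotent groups, in particular for finite \<open>p\<close>-groups;
  for other groups the \<open>LEAST\<close> is unspecified.\<close>

definition nilpotency_class :: "('a, 'b) monoid_scheme \<Rightarrow> nat" where
  "nilpotency_class G = (LEAST c. upper_central G c = carrier G)"

text \<open>For \<open>|G| = p\<^sup>n\<close> with \<open>p\<close> prime, \<open>multiplicity p |G|\<close> is \<open>n\<close>.
  The difference is taken in the integers so that it is not truncated.\<close>

definition coclass :: "nat \<Rightarrow> ('a, 'b) monoid_scheme \<Rightarrow> int" where
  "coclass p G = int (multiplicity p (order G)) - int (nilpotency_class G)"

definition maximal_subgroup :: "'a set \<Rightarrow> ('a, 'b) monoid_scheme \<Rightarrow> bool" where
  "maximal_subgroup M G \<longleftrightarrow> subgroup M G \<and> M \<noteq> carrier G \<and>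
     (\<forall>H. subgroup H G \<and> M \<subseteq> H \<longrightarrow> H = M \<or> H = carrier G)"

text \<open>The intersection with \<open>carrier G\<close> fixes the usual convention that
  \<open>\<Phi>(G) = G\<close> if \<open>G\<close> has no maximal subgroup.\<close>

definition frattini :: "('a, 'b) monoid_scheme \<Rightarrow> 'a set" where
  "frattini G = carrier G \<inter> \<Inter> {M. maximal_subgroup M G}"

text \<open>Like the elements of \<^const>\<open>auto\<close>, inner automorphisms are extensional
  functions, i.e. they are undefined outside the carrier.\<close>

definition inner_auto :: "('a, 'b) monoid_scheme \<Rightarrow> ('a \<Rightarrow> 'a) set" where
  "inner_auto G = (\<lambda>g. \<lambda>x \<in> carrier G. g \<otimes>\<^bsub>G\<^esub> x \<otimes>\<^bsub>G\<^esub> inv\<^bsub>G\<^esub> g) ` carrier G"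

end

theory Submission
  imports Defs "HOL-Algebra.Group_Action" "HOL-Algebra.Sylow" "HOL-Algebra.Generated_Groups"
begin

text \<open>Automorphisms are obtained as \<open>u \<mapsto> u \<delta>(u)\<close> for crossed homomorphisms \<open>\<delta>\<close> into a small
  normal subgroup. For a maximal subgroup \<open>M\<close>, an element \<open>x\<close> of order \<open>p\<close> in \<open>Z(M)\<close> and
  \<open>g \<notin> M\<close> with \<open>[x, g]\<close> central, there is such an automorphism fixing \<open>M\<close>, hence \<open>\<Phi>(G)\<close>, and sending
  \<open>g\<close> to \<open>g x\<close>. If all of these with \<open>x\<close> central are inner and the class \<open>c = n - 2\<close> is at least 3,
  then they embed \<open>Hom(G, Z(G))\<close> into \<open>Z\<^sub>2 / Z\<^sub>1\<close>. As the coclass is 2, this forces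
  \<open>|Z\<^sub>1| = p\<close>, \<open>|Z\<^sub>i| = p\<^sup>i\<^sup>+\<^sup>1\<close> for \<open>2 \<le> i < c\<close>, and the centralizer of \<open>Z\<^sub>2\<close> is \<open>Z\<^sub>c\<^sub>-\<^sub>1\<close>.
  Now take \<open>x \<in> Z\<^sub>2 \<setminus> Z\<^sub>1\<close> of order \<open>p\<close> and \<open>M\<close> its centralizer. If the automorphism for \<open>M\<close> and \<open>x\<close>
  is inner as well, it is induced by some \<open>y \<in> Z\<^sub>3 \<setminus> Z\<^sub>2\<close> commuting with \<open>M\<close>, so that \<open>c \<ge> 4\<close>. In that case
  \<open>G / Z\<^sub>c\<^sub>-\<^sub>2\<close> is the extraspecial group of order \<open>p\<^sup>3\<close> and exponent \<open>p\<close>. Its freeness among the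
  two-generator groups of class 2 and exponent \<open>p\<close> gives an automorphism of \<open>G\<close> that fixes
  \<open>Z\<^sub>c\<^sub>-\<^sub>2 = Z\<^sub>n\<^sub>-\<^sub>4\<close> and sends \<open>h\<close> to \<open>h x\<close> for some \<open>h \<in> M\<close>. It is not inner: otherwise it would be
  induced by an element of \<open>Z\<^sub>3 = \<langle>y\<rangle> Z\<^sub>2\<close>, and since \<open>y\<close> commutes with \<open>h\<close>, this gives \<open>x \<in> [h, Z\<^sub>2] \<subseteq> Z\<^sub>1\<close>.\<close>

section \<open>Commutators and the upper central series\<close>

context group begin

definition commutator :: "'a \<Rightarrow> 'a \<Rightarrow> 'a" where
  "commutator a b = inv a \<otimes> inv b \<otimes> a \<otimes> b"

lemma cancel_left_inv [simp]:
  "\<lbrakk>a \<in> carrier G; b \<in> carrier G\<rbrakk> \<Longrightarrow> inv a \<otimes> (a \<otimes> b) = b"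
  "\<lbrakk>a \<in> carrier G; b \<in> carrier G\<rbrakk> \<Longrightarrow> a \<otimes> (inv a \<otimes> b) = b"
  by (simp_all flip: m_assoc)

lemma commutator_closed [simp, intro]:
  "\<lbrakk>a \<in> carrier G; b \<in> carrier G\<rbrakk> \<Longrightarrow> commutator a b \<in> carrier G"
  by (simp add: commutator_def)

lemma mult_commutator:
  "\<lbrakk>a \<in> carrier G; b \<in> carrier G\<rbrakk> \<Longrightarrow> b \<otimes> a \<otimes> commutator a b = a \<otimes> b"
  by (simp add: commutator_def m_assoc)

lemma conj_eq_commutator:
  "\<lbrakk>a \<in> carrier G; b \<in> carrier G\<rbrakk> \<Longrightarrow> inv b \<otimes> a \<otimes> b = a \<otimes> commutator a b"
  by (simp add: commutator_def m_assoc)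

lemma commutator_eq_one_iff:
  assumes "a \<in> carrier G" "b \<in> carrier G"
  shows "commutator a b = \<one> \<longleftrightarrow> a \<otimes> b = b \<otimes> a"
  using mult_commutator[OF assms] assms
  by (metis commutator_closed l_cancel_one m_closed)

lemma inv_commutator:
  "\<lbrakk>a \<in> carrier G; b \<in> carrier G\<rbrakk> \<Longrightarrow> inv (commutator a b) = commutator b a"
  by (simp add: commutator_def m_assoc inv_mult_group)

lemma commutator_mult_right:
  "\<lbrakk>a \<in> carrier G; b \<in> carrier G; c \<in> carrier G\<rbrakk>
    \<Longrightarrow> commutator a (b \<otimes> c) = commutator a c \<otimes> (inv c \<otimes> commutator a b \<otimes> c)"
  by (simp add: commutator_def m_assoc inv_mult_group)

lemma commutator_mult_left:
  "\<lbrakk>a \<in> carrier G; b \<in> carrier G; c \<in> carrier G\<rbrakk>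
    \<Longrightarrow> commutator (a \<otimes> b) c = inv b \<otimes> commutator a c \<otimes> b \<otimes> commutator b c"
  by (simp add: commutator_def m_assoc inv_mult_group)

lemma conj_int_pow:
  assumes "a \<in> carrier G" "b \<in> carrier G"
  shows "inv b \<otimes> a [^] (i::int) \<otimes> b = (inv b \<otimes> a \<otimes> b) [^] i"
proof -
  have "(\<lambda>x. inv b \<otimes> x \<otimes> b) \<in> hom G G"
    using assms by (auto simp: hom_def m_assoc)
  from hom_int_pow[OF this assms(1) is_group is_group] show ?thesis by simp
qed

lemma int_pow_commutes:
  assumes "a \<otimes> b = b \<otimes> a" "a \<in> carrier G" "b \<in> carrier G"
  shows "a [^] (i::int) \<otimes> b = b \<otimes> a [^] i"
proof -
  have "inv b \<otimes> a \<otimes> b = a"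
    using assms by (simp add: m_assoc)
  then have "inv b \<otimes> a [^] i \<otimes> b = a [^] i"
    using conj_int_pow[of a b i] assms by simp
  then show ?thesis
    using assms by (metis int_pow_closed inv_solve_left' m_assoc m_closed inv_closed)
qed

text \<open>Conjugation by \<open>b\<close> sends \<open>a\<close> to
  \<open>a \<otimes> commutator a b\<close>; a power of this product splits since its factors
  commute.\<close>

lemma commutator_int_pow_left:
  assumes "a \<in> carrier G" "b \<in> carrier G" "commutator a b \<otimes> a = a \<otimes> commutator a b"
  shows "commutator (a [^] (i::int)) b = commutator a b [^] i"
proof -
  have "a [^] i \<otimes> commutator (a [^] i) b = (a \<otimes> commutator a b) [^] i"
    using assms by (simp add: conj_int_pow flip: conj_eq_commutator)
  also have "\<dots> = a [^] i \<otimes> commutator a b [^] i"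
    using assms by (intro int_pow_mult_distrib) auto
  finally show ?thesis using assms by simp
qed

lemma commutator_int_pow_right:
  assumes "a \<in> carrier G" "b \<in> carrier G" "commutator a b \<otimes> b = b \<otimes> commutator a b"
  shows "commutator a (b [^] (i::int)) = commutator a b [^] i"
proof -
  have "commutator b a \<otimes> b = b \<otimes> commutator b a"
    using assms by (metis commutator_closed int_pow_1 int_pow_commutes int_pow_neg inv_commutator)
  then have "commutator (b [^] i) a = commutator b a [^] i"
    using assms by (intro commutator_int_pow_left) auto
  then show ?thesis using assms
    by (metis commutator_closed int_pow_closed int_pow_inv inv_commutator)
qed

lemma commutator_int_pow_both:
  assumes "h \<in> carrier G" "g \<in> carrier G"
    and "commutator h g \<otimes> h = h \<otimes> commutator h g"
    and "commutator h g \<otimes> g = g \<otimes> commutator h g"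
  shows "h [^] (j::int) \<otimes> g [^] (i::int) = g [^] i \<otimes> h [^] j \<otimes> commutator h g [^] (i * j)"
proof -
  have *: "commutator (h [^] j) g = commutator h g [^] j"
    using assms by (intro commutator_int_pow_left) auto
  have "commutator (h [^] j) (g [^] i) = (commutator h g [^] j) [^] i"
    using assms * by (subst commutator_int_pow_right) (auto intro!: int_pow_commutes)
  then have "commutator (h [^] j) (g [^] i) = commutator h g [^] (i * j)"
    using assms by (simp add: int_pow_pow mult.commute)
  then show ?thesis
    using mult_commutator[of "h [^] j" "g [^] i"] assms by simp
qed

text \<open>Each \<open>h\<close> that moves right past a \<open>g\<close> leaves one factor
  \<open>commutator h g\<close>, and sorting \<open>n\<close> copies of \<open>g \<otimes> h\<close>
  takes \<open>n * (n - 1) div 2\<close> such moves.\<close>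

lemma class2_pow:
  fixes n :: nat
  assumes "h \<in> carrier G" "g \<in> carrier G"
    and "commutator h g \<otimes> h = h \<otimes> commutator h g"
    and "commutator h g \<otimes> g = g \<otimes> commutator h g"
  shows "(g \<otimes> h) [^] n = g [^] n \<otimes> h [^] n \<otimes> commutator h g [^] (n * (n - 1) div 2)"
proof (induction n)
  case 0
  then show ?case using assms by simp
next
  case (Suc n)
  let ?k = "commutator h g" and ?s = "n * (n - 1) div 2"
  have k: "?k \<in> carrier G" using assms by simp
  have kg: "?k [^] m \<otimes> (g \<otimes> w) = g \<otimes> (?k [^] m \<otimes> w)" if "w \<in> carrier G" for m :: nat and w
    using int_pow_commutes[of ?k g "int m"] assms that by (simp add: int_pow_int flip: m_assoc)
  have kh: "?k [^] m \<otimes> h = h \<otimes> ?k [^] m" for m :: nat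
    using int_pow_commutes[of ?k h "int m"] assms by (simp add: int_pow_int)
  have kh': "?k [^] m \<otimes> (h \<otimes> w) = h \<otimes> (?k [^] m \<otimes> w)" if "w \<in> carrier G" for m :: nat and w
    using kh[of m] assms that by (simp flip: m_assoc)
  have hg: "h [^] n \<otimes> (g \<otimes> w) = g \<otimes> (h [^] n \<otimes> (?k [^] n \<otimes> w))" if "w \<in> carrier G" for w
    using commutator_int_pow_both[OF assms, of "int n" 1] assms that
    by (simp add: int_pow_int flip: m_assoc)
  have "even (n * (n - 1))" by (cases n) auto
  then have s: "Suc n * (Suc n - 1) div 2 = n + ?s"
    by (cases n) (auto simp: algebra_simps)
  have "(g \<otimes> h) [^] Suc n = g [^] n \<otimes> (h [^] n \<otimes> (?k [^] ?s \<otimes> (g \<otimes> h)))"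
    using Suc assms by (simp add: m_assoc)
  also have "\<dots> = g [^] n \<otimes> (g \<otimes> (h [^] n \<otimes> (h \<otimes> (?k [^] n \<otimes> ?k [^] ?s))))"
    using assms by (simp add: kg hg kh kh')
  also have "\<dots> = g [^] Suc n \<otimes> h [^] Suc n \<otimes> ?k [^] (n + ?s)"
    using assms by (simp add: m_assoc nat_pow_mult)
  finally show ?case unfolding s .
qed

text \<open>For odd \<open>p\<close> the exponent \<open>p * (p - 1) div 2\<close> is a multiple of
  \<open>p\<close>, so the correction factor of \<open>class2_pow\<close> is trivial.\<close>

lemma class2_odd_pow:
  assumes "h \<in> carrier G" "g \<in> carrier G"
    and "commutator h g \<otimes> h = h \<otimes> commutator h g"
    and "commutator h g \<otimes> g = g \<otimes> commutator h g"
    and "commutator h g [^] (p::nat) = \<one>" "odd p"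
  shows "(g \<otimes> h) [^] p = g [^] p \<otimes> h [^] p"
proof -
  have "p * (p - 1) div 2 = p * ((p - 1) div 2)"
    using \<open>odd p\<close> by (simp add: div_mult_swap)
  then have "commutator h g [^] (p * (p - 1) div 2) = \<one>"
    using assms by (metis commutator_closed nat_pow_one nat_pow_pow)
  then show ?thesis using class2_pow[OF assms(1-4), of p] assms by simp
qed

section \<open>Commuting modulo a normal subgroup and the upper central series\<close>

lemma rcos_eq_iff:
  assumes "subgroup N G" "x \<in> carrier G" "y \<in> carrier G"
  shows "N #> x = N #> y \<longleftrightarrow> x \<otimes> inv y \<in> N"
  using assms
  by (metis rcos_self repr_independence subgroup.rcos_module group_axioms)

lemma normal_conj_closed:
  assumes "N \<lhd> G" "a \<in> N" "b \<in> carrier G"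
  shows "inv b \<otimes> a \<otimes> b \<in> N"
  using assms by (simp add: normal.inv_op_closed1)

lemma normal_conj_iff:
  assumes "N \<lhd> G" "a \<in> carrier G" "b \<in> carrier G"
  shows "inv b \<otimes> a \<otimes> b \<in> N \<longleftrightarrow> a \<in> N"
proof
  assume "inv b \<otimes> a \<otimes> b \<in> N"
  from normal.inv_op_closed2[OF assms(1,3) this] show "a \<in> N"
    using assms by (simp add: m_assoc)
qed (rule normal_conj_closed[OF assms(1) _ assms(3)])

text \<open>Turns commuting in the quotient into membership of a commutator, so that the upper
  central series can be handled by elements of \<open>G\<close>.\<close>

lemma Mod_commute_iff:
  assumes "N \<lhd> G" "x \<in> carrier G" "y \<in> carrier G"
  shows "(N #> x) \<otimes>\<^bsub>G Mod N\<^esub> (N #> y) = (N #> y) \<otimes>\<^bsub>G Mod N\<^esub> (N #> x)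
    \<longleftrightarrow> commutator x y \<in> N"
proof -
  interpret N: normal N G by fact
  have "(N #> x) \<otimes>\<^bsub>G Mod N\<^esub> (N #> y) = (N #> y) \<otimes>\<^bsub>G Mod N\<^esub> (N #> x)
      \<longleftrightarrow> (x \<otimes> y) \<otimes> inv (y \<otimes> x) \<in> N"
    using assms by (simp add: N.rcos_sum rcos_eq_iff N.is_subgroup)
  also have "(x \<otimes> y) \<otimes> inv (y \<otimes> x) = y \<otimes> x \<otimes> commutator x y \<otimes> inv (y \<otimes> x)"
    using assms by (simp add: mult_commutator)
  also have "\<dots> \<in> N \<longleftrightarrow> commutator x y \<in> N"
  proof
    assume *: "y \<otimes> x \<otimes> commutator x y \<otimes> inv (y \<otimes> x) \<in> N"
    have "commutator x y = inv (y \<otimes> x) \<otimes> (y \<otimes> x \<otimes> commutator x y \<otimes> inv (y \<otimes> x)) \<otimes> (y \<otimes> x)"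
      using assms by (simp add: m_assoc inv_mult_group)
    also have "\<dots> \<in> N" using * assms by (intro normal_conj_closed) auto
    finally show "commutator x y \<in> N" .
  next
    assume "commutator x y \<in> N"
    then show "y \<otimes> x \<otimes> commutator x y \<otimes> inv (y \<otimes> x) \<in> N"
      using assms by (intro N.inv_op_closed2) auto
  qed
  finally show ?thesis .
qed

lemma normal_commutator:
  assumes "N \<lhd> G" "a \<in> N" "b \<in> carrier G"
  shows "commutator a b \<in> N" "commutator b a \<in> N"
proof -
  interpret N: normal N G by fact
  have "inv a \<otimes> (inv b \<otimes> a \<otimes> b) \<in> N"
    using assms by (intro N.m_closed normal_conj_closed) auto
  then show *: "commutator a b \<in> N"
    using assms by (simp add: commutator_def m_assoc)
  show "commutator b a \<in> N"
    using assms N.m_inv_closed[OF *] by (simp add: inv_commutator)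
qed

text \<open>The set is the full preimage of the center of \<open>G Mod N\<close>; this is the
  induction step for the normality of the upper central series.\<close>

lemma normal_center_mod:
  assumes N: "N \<lhd> G"
  shows "{x \<in> carrier G. \<forall>u \<in> carrier G. commutator x u \<in> N} \<lhd> G" (is "?C \<lhd> G")
proof -
  interpret N: normal N G by fact
  show ?thesis
  proof (rule normal_invI)
    show "subgroup ?C G"
    proof (unfold_locales)
      show "?C \<subseteq> carrier G" by blast
      show "\<one> \<in> ?C" by (simp add: commutator_def)
    next
      fix x y assume xy: "x \<in> ?C" "y \<in> ?C"
      have "commutator (x \<otimes> y) u \<in> N" if "u \<in> carrier G" for u
        using xy that by (simp add: commutator_mult_left N.m_closed normal_conj_closed[OF N])
      with xy show "x \<otimes> y \<in> ?C" by auto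
    next
      fix x assume x: "x \<in> ?C"
      have "commutator (inv x) u \<in> N" if u: "u \<in> carrier G" for u
      proof -
        have "commutator (inv x) u = inv (inv x) \<otimes> inv (commutator x u) \<otimes> inv x"
          using x u by (simp add: commutator_def m_assoc inv_mult_group)
        also have "\<dots> \<in> N"
          using x u by (intro normal_conj_closed[OF N]) auto
        finally show ?thesis .
      qed
      with x show "inv x \<in> ?C" by auto
    qed
  next
    fix x h assume x: "x \<in> carrier G" and h: "h \<in> ?C"
    define c where "c = commutator h (inv x)"
    have c: "c \<in> N" "c \<in> carrier G" using h x by (auto simp: c_def)
    have "x \<otimes> h \<otimes> inv x = h \<otimes> c"
      using x h conj_eq_commutator[of h "inv x"] by (simp add: c_def)
    moreover have "commutator (h \<otimes> c) u \<in> N" if u: "u \<in> carrier G" for u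
      using h c u
      by (simp add: commutator_mult_left N.m_closed normal_conj_closed[OF N] normal_commutator[OF N])
    ultimately show "x \<otimes> h \<otimes> inv x \<in> ?C"
      using x h c by auto
  qed
qed

lemma normal_upper_central: "upper_central G i \<lhd> G"
proof (induction i)
  case 0
  then show ?case by (simp add: one_is_normal)
next
  case (Suc i)
  have "upper_central G (Suc i)
      = {x \<in> carrier G. \<forall>u \<in> carrier G. commutator x u \<in> upper_central G i}"
    using Mod_commute_iff[OF Suc] by (auto simp: group_center_def carrier_FactGroup)
  then show ?case using normal_center_mod[OF Suc] by simp
qed

text \<open>The elementwise description by which membership is decided later, in place of the coset
  definition.\<close>

lemma upper_central_Suc_iff:
  "x \<in> upper_central G (Suc i) \<longleftrightarrow>
    x \<in> carrier G \<and> (\<forall>u \<in> carrier G. commutator x u \<in> upper_central G i)"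
  using Mod_commute_iff[OF normal_upper_central, of x _ i]
  by (auto simp: group_center_def carrier_FactGroup)

end

declare upper_central.simps(2) [simp del]

lemma (in group) subgroup_upper_central: "subgroup (upper_central G i) G"
  by (rule normal_imp_subgroup[OF normal_upper_central])

lemma (in group) upper_central_mono_Suc: "upper_central G i \<subseteq> upper_central G (Suc i)"
  using subgroup.subset[OF subgroup_upper_central[of i]]
  by (auto simp: upper_central_Suc_iff intro: normal_commutator[OF normal_upper_central])

lemma (in group) upper_central_mono: "i \<le> j \<Longrightarrow> upper_central G i \<subseteq> upper_central G j"
  by (rule lift_Suc_mono_le[of "upper_central G", OF upper_central_mono_Suc])

text \<open>The class equation: were the center trivial, every conjugacy class other than
  \<open>{\<one>}\<close> would have size divisible by \<open>p\<close>, so the order would be 1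
  modulo \<open>p\<close>.\<close>

lemma (in group) p_group_center_nontrivial:
  assumes "Factorial_Ring.prime (p::nat)" "order G = p ^ k" "k > 0"
  shows "\<exists>z \<in> group_center G. z \<noteq> \<one>"
proof (rule ccontr)
  assume triv: "\<not> ?thesis"
  let ?\<phi> = "\<lambda>g. \<lambda>h \<in> carrier G. g \<otimes> h \<otimes> inv g"
  interpret A: group_action G "carrier G" ?\<phi>
    by (rule action_by_conjugation)
  have "order G > 0" using assms by (simp add: prime_gt_0_nat)
  then have fin: "finite (carrier G)" using order_gt_0_iff_finite by simp
  define O1 where "O1 = orbits G (carrier G) ?\<phi>"
  have one: "orbit G ?\<phi> \<one> = {\<one>}"
  proof -
    have "x = \<one>" if "x \<in> orbit G ?\<phi> \<one>" for x using that by (auto simp: orbit_def)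
    then show ?thesis using A.orbit_refl[OF one_closed] by auto
  qed
  then have O1_one: "{\<one>} \<in> O1" by (force simp: O1_def orbits_def)
  have fO: "finite O1" using fin by (auto simp: O1_def orbits_def)
  have "p dvd card C" if C: "C \<in> O1 - {{\<one>}}" for C
  proof -
    obtain x where x: "x \<in> carrier G" "C = orbit G ?\<phi> x" "x \<noteq> \<one>"
      using C one by (auto simp: O1_def orbits_def)
    have "card C dvd p ^ k"
      unfolding x(2) assms(2)[symmetric] A.orbit_stabilizer_theorem[OF x(1), symmetric]
      by (rule dvd_triv_left)
    moreover have "card C \<noteq> 1"
    proof
      assume "card C = 1"
      then obtain y where y: "C = {y}" by (auto simp: card_1_singleton_iff)
      have "x = y" using A.orbit_refl[OF x(1)] y x(2) by simp
      have "x \<otimes> u = u \<otimes> x" if u: "u \<in> carrier G" for u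
      proof -
        have "?\<phi> u x \<in> C" unfolding x(2) orbit_def by (rule CollectI, rule exI[of _ u]) (simp add: u)
        then have "?\<phi> u x = x" using y \<open>x = y\<close> by (simp only: singleton_iff)
        then have "u \<otimes> x \<otimes> inv u = x" using x by simp
        then show ?thesis using x u by (metis inv_solve_right' m_closed)
      qed
      then have "x \<in> group_center G" using x by (auto simp: group_center_def)
      with triv x show False by auto
    qed
    ultimately show ?thesis
      using assms(1) by (metis divides_primepow_nat dvd_power gr0I power_0)
  qed
  then have "p dvd (\<Sum>C\<in>O1 - {{\<one>}}. card C)" by (rule dvd_sum)
  moreover have "(\<Sum>C\<in>O1. card C) = order G"
  proof -
    have card_eq: "sum (\<lambda>_::'a. 1::nat) = card" by (rule ext) simp
    then show ?thesis
      using A.disjoint_sum[OF fin, of "\<lambda>_. 1::nat", unfolded card_eq] by (simp add: O1_def order_def)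
  qed
  moreover have "(\<Sum>C\<in>O1. card C) = 1 + (\<Sum>C\<in>O1 - {{\<one>}}. card C)"
    using fO O1_one by (subst sum.remove[of _ "{\<one>}"]) auto
  ultimately have "p dvd 1"
    using assms by (metis dvd_add_left_iff dvd_power)
  then show False using assms(1) by (metis not_prime_unit)
qed

section \<open>Factors of prime order and sizes of kernels\<close>

lemma (in group) prime_order_cyclic:
  assumes "order G = p" "Factorial_Ring.prime (p::nat)" "a \<in> carrier G" "a \<noteq> \<one>" "u \<in> carrier G"
  shows "\<exists>i::nat. u = a [^] i"
proof -
  have fin: "finite (carrier G)"
    using assms by (metis order_gt_0_iff_finite prime_gt_0_nat)
  have "ord a dvd p" using ord_dvd_group_order[OF assms(3)] assms by simp
  then have "ord a = p" using assms by (metis ord_eq_1 prime_nat_iff)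
  then have "card ((\<lambda>i. a [^] i) ` {0..ord a - 1}) = p"
    using ord_inj[OF assms(3)] prime_gt_0_nat[OF assms(2)] by (simp add: card_image)
  then have "(\<lambda>i::nat. a [^] i) ` {0..ord a - 1} = carrier G"
    using assms fin by (intro card_subset_eq) (auto simp: order_def)
  then show ?thesis using assms by blast
qed

text \<open>The factor \<open>K / N\<close> has order \<open>p\<close>, so it is cyclic and every
  coset except \<open>N\<close> generates it.\<close>

lemma (in group) prime_index:
  assumes "N \<lhd> G" "subgroup K G" "N \<subseteq> K" "finite (carrier G)"
    and "card K = p * card N" "Factorial_Ring.prime (p::nat)" "u \<in> K"
  shows prime_index_pow: "u [^] p \<in> N"
    and prime_index_decomp: "\<lbrakk>a \<in> K; a \<notin> N\<rbrakk> \<Longrightarrow> \<exists>i::nat. \<exists>b \<in> N. u = a [^] i \<otimes> b"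
proof -
  let ?K = "G\<lparr>carrier := K\<rparr>"
  interpret K: group ?K using assms subgroup_imp_group by blast
  have "N \<lhd> ?K" using assms by (simp add: normal_restrict_supergroup)
  then interpret N: normal N ?K .
  interpret NG: normal N G by fact
  interpret Q: group "?K Mod N" by (rule N.factorgroup_is_group)
  have cN: "card N > 0"
    using assms NG.one_closed NG.subset by (metis card_gt_0_iff empty_iff finite_subset)
  have "card (rcosets\<^bsub>?K\<^esub> N) * card N = p * card N"
    using K.lagrange[OF N.is_subgroup] assms by (simp add: order_def)
  then have ordQ: "order (?K Mod N) = p"
    using cN by (simp add: order_def FactGroup_def)
  have memQ: "N #> a \<in> carrier (?K Mod N)" if "a \<in> K" for a
    using that by (simp add: carrier_FactGroup)
  have powQ: "(N #> a) [^]\<^bsub>?K Mod N\<^esub> (k::nat) = N #> a [^] k" if "a \<in> K" for a k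
    using N.FactGroup_pow[of a k] that by (simp add: nat_pow_consistent[symmetric])
  have Kc: "K \<subseteq> carrier G" using assms subgroup.subset by blast
  have "(N #> u) [^]\<^bsub>?K Mod N\<^esub> p = N"
    using Q.pow_order_eq_1[OF memQ[OF assms(7)]] ordQ by simp
  then have "N #> u [^] p = N" using powQ assms by simp
  then show "u [^] p \<in> N"
    using Kc assms by (metis NG.is_subgroup nat_pow_closed rcos_self subsetD)
  assume a: "a \<in> K" "a \<notin> N"
  have "N #> a \<noteq> N" using a Kc by (metis NG.is_subgroup rcos_self subsetD)
  then obtain i :: nat where "N #> u = (N #> a) [^]\<^bsub>?K Mod N\<^esub> i"
    using Q.prime_order_cyclic[OF ordQ assms(6) memQ[OF a(1)] _ memQ[OF assms(7)]] by auto
  then have "N #> u = N #> a [^] i" using powQ a by simp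
  then have *: "u \<otimes> inv (a [^] i) \<in> N"
    using rcos_eq_iff[OF NG.is_subgroup] a Kc assms by blast
  have ac: "a \<in> carrier G" "u \<in> carrier G" using a Kc assms by auto
  have "inv (a [^] i) \<otimes> (u \<otimes> inv (a [^] i)) \<otimes> a [^] i \<in> N"
    using * ac by (intro normal_conj_closed assms) auto
  then have "inv (a [^] i) \<otimes> u \<in> N" using ac by (simp add: m_assoc)
  moreover have "u = a [^] i \<otimes> (inv (a [^] i) \<otimes> u)" using ac by simp
  ultimately show "\<exists>i::nat. \<exists>b \<in> N. u = a [^] i \<otimes> b" by blast
qed

text \<open>The index of the kernel is at most the size of any finite set holding the image. Applied
  to \<open>commutator x\<close>, whose kernel is the centralizer of \<open>x\<close>, and to the
  \<open>p\<close>-th power map.\<close>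

lemma (in group) hom_card_le:
  assumes "f \<in> hom G G" "f ` carrier G \<subseteq> W" "finite W"
  shows "order G \<le> card W * card {u \<in> carrier G. f u = \<one>}"
proof -
  interpret f: group_hom G G f using assms(1) by unfold_locales
  let ?Q = "G Mod kernel G G f"
  have eq: "kernel G G f #> u = kernel G G f #> inv_into (carrier G) f (f u)"
    if "u \<in> carrier G" for u
    using that by (intro equalityI f.FactGroup_subset) (simp_all add: inv_into_into f_inv_into_f)
  have "carrier ?Q \<subseteq> (\<lambda>w. kernel G G f #> inv_into (carrier G) f w) ` (f ` carrier G)"
  proof
    fix X assume "X \<in> carrier ?Q"
    then obtain u where "u \<in> carrier G" "X = kernel G G f #> u"
      unfolding carrier_FactGroup by blast
    then show "X \<in> (\<lambda>w. kernel G G f #> inv_into (carrier G) f w) ` (f ` carrier G)"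
      using eq by blast
  qed
  moreover have finW: "finite (f ` carrier G)" using assms(2,3) by (rule finite_subset)
  ultimately have "card (carrier ?Q) \<le> card (f ` carrier G)"
    by (rule surj_card_le[rotated])
  also have "\<dots> \<le> card W" by (rule card_mono[OF assms(3,2)])
  finally have "card (carrier ?Q) \<le> card W" .
  moreover have "order G = card (carrier ?Q) * card (kernel G G f)"
    using lagrange[OF f.subgroup_kernel] by (simp add: FactGroup_def)
  ultimately show ?thesis unfolding kernel_def by (simp only: mult_le_mono1)
qed

section \<open>Automorphisms from crossed homomorphisms\<close>


lemma (in group) int_pow_cong:
  assumes "a \<in> carrier G" "a [^] (p::nat) = \<one>" "int p dvd i - j"
  shows "a [^] i = a [^] j"
proof -
  have "ord a dvd p" using assms pow_eq_id by simp
  then have "int (ord a) dvd j - i"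
    using assms(3) by (meson dvd_diff_commute dvd_trans int_dvd_int_iff)
  then show ?thesis using assms(1) int_pow_eq by simp
qed

text \<open>By Bezout, if \<open>p\<close> did not divide \<open>i\<close>, then \<open>a\<close>
  would be a product of powers of \<open>a [^] p\<close> and \<open>a [^] i\<close> and lie in
  \<open>H\<close>.\<close>

lemma (in group) int_pow_mem_prime:
  assumes "subgroup H G" "a \<in> carrier G" "a \<notin> H" "a [^] (p::nat) \<in> H"
    and "Factorial_Ring.prime p" "a [^] (i::int) \<in> H"
  shows "int p dvd i"
proof (rule ccontr)
  assume "\<not> int p dvd i"
  then have "coprime (int p) i"
    using assms(5) by (simp add: prime_imp_coprime)
  then obtain r s where "r * int p + s * i = 1"
    by (metis bezout_int coprime_imp_gcd_eq_1)
  then have "a = a [^] (int p * r + i * s)"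
    using assms(2) by (simp add: mult.commute)
  also have "\<dots> = (a [^] int p) [^] r \<otimes> (a [^] i) [^] s"
    using assms(2) by (simp add: int_pow_mult int_pow_pow)
  also have "\<dots> \<in> H"
    using assms subgroup_int_pow_closed[OF assms(1)]
    by (simp add: int_pow_int subgroup.m_closed)
  finally show False using assms(3) by blast
qed

text \<open>A crossed homomorphism \<open>\<delta>\<close> of exponent \<open>p\<close> which vanishes on its own values yields
  the automorphism \<open>u \<mapsto> u \<delta>(u)\<close>, whose \<open>k\<close>-th iterate is \<open>u \<mapsto> u \<delta>(u)\<^sup>k\<close>.\<close>

lemma (in group) crossed_hom_auto:
  assumes closed: "\<And>u. u \<in> carrier G \<Longrightarrow> \<delta> u \<in> carrier G"
    and crossed: "\<And>u v. \<lbrakk>u \<in> carrier G; v \<in> carrier G\<rbrakk> \<Longrightarrow> \<delta> (u \<otimes> v) = inv v \<otimes> \<delta> u \<otimes> v \<otimes> \<delta> v"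
    and square: "\<And>u. u \<in> carrier G \<Longrightarrow> \<delta> (\<delta> u) = \<one>"
    and exponent: "\<And>u. u \<in> carrier G \<Longrightarrow> \<delta> u [^] (p::nat) = \<one>"
    and nontriv: "w \<in> carrier G" "\<delta> w \<noteq> \<one>"
    and p: "Factorial_Ring.prime p"
  defines "\<alpha> \<equiv> \<lambda>u \<in> carrier G. u \<otimes> \<delta> u"
  shows "\<alpha> \<in> auto G" and "group.ord (AutoGroup G) \<alpha> = p"
proof -
  have hom: "\<alpha> \<in> hom G G"
    by (rule homI) (auto simp: \<alpha>_def closed crossed m_assoc)
  interpret \<alpha>: group_hom G G \<alpha> using hom by unfold_locales
  \<comment> \<open>The values of \<open>\<delta>\<close> are fixed points, so each application of
    \<open>\<alpha>\<close> contributes one more factor \<open>\<delta> u\<close>.\<close>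
  have fixed: "\<alpha> (\<delta> u) = \<delta> u" if "u \<in> carrier G" for u
    using that by (simp add: \<alpha>_def closed square)
  have iter: "(\<alpha> ^^ k) u = u \<otimes> \<delta> u [^] k" if u: "u \<in> carrier G" for u k
  proof (induction k)
    case 0
    then show ?case using u by simp
  next
    case (Suc k)
    have "\<alpha> (u \<otimes> \<delta> u [^] k) = \<alpha> u \<otimes> \<alpha> (\<delta> u) [^] k"
      using u closed by (simp add: \<alpha>.hom_nat_pow)
    also have "\<dots> = u \<otimes> (\<delta> u \<otimes> \<delta> u [^] k)"
      using u closed fixed by (simp add: \<alpha>_def m_assoc)
    also have "\<dots> = u \<otimes> \<delta> u [^] Suc k"
      using nat_pow_Suc2[OF closed[OF u], of k] by simp
    finally show ?case using Suc by simp
  qed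
  have p0: "p = Suc (p - 1)" using prime_gt_0_nat[OF p] by simp
  have iter_p: "(\<alpha> ^^ p) u = u" if "u \<in> carrier G" for u
    using iter[OF that] exponent[OF that] that by simp
  \<comment> \<open>The \<open>p\<close>-th iterate is the identity, so iterate number
    \<open>p - 1\<close> is the inverse.\<close>
  have bij: "bij_betw \<alpha> (carrier G) (carrier G)"
  proof (rule bij_betw_byWitness[where f' = "\<alpha> ^^ (p - 1)"])
    show "\<forall>u\<in>carrier G. (\<alpha> ^^ (p - 1)) (\<alpha> u) = u"
      using iter_p p0 by (metis comp_apply funpow_Suc_right)
    show "\<forall>u\<in>carrier G. \<alpha> ((\<alpha> ^^ (p - 1)) u) = u"
      using iter_p p0 by (metis comp_apply funpow.simps(2))
    show "\<alpha> ` carrier G \<subseteq> carrier G" using \<alpha>.hom_closed by blast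
    show "(\<alpha> ^^ (p - 1)) ` carrier G \<subseteq> carrier G" using iter closed by auto
  qed
  show auto: "\<alpha> \<in> auto G"
    using hom bij by (simp add: auto_def Bij_def \<alpha>_def)
  interpret A: group "AutoGroup G" by (rule AutoGroup)
  have carr: "\<alpha> \<in> carrier (AutoGroup G)" using auto by (simp add: AutoGroup_def)
  \<comment> \<open>Elements of \<open>AutoGroup G\<close> are extensional, whence the restriction
    of the iterates to the carrier.\<close>
  have pow: "\<alpha> [^]\<^bsub>AutoGroup G\<^esub> (k::nat) = (\<lambda>u \<in> carrier G. (\<alpha> ^^ k) u)" for k
  proof (induction k)
    case 0
    then show ?case by (auto simp: AutoGroup_def BijGroup_def)
  next
    case (Suc k)
    have "(\<lambda>u \<in> carrier G. (\<alpha> ^^ k) u) \<in> Bij (carrier G)"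
      using A.nat_pow_closed[OF carr, of k] unfolding Suc by (simp add: AutoGroup_def auto_def)
    moreover have "\<alpha> \<in> Bij (carrier G)" using auto by (simp add: auto_def)
    moreover have "\<alpha> [^]\<^bsub>AutoGroup G\<^esub> Suc k
        = (\<lambda>u \<in> carrier G. (\<alpha> ^^ k) u) \<otimes>\<^bsub>AutoGroup G\<^esub> \<alpha>"
      unfolding A.nat_pow_Suc Suc ..
    ultimately have "\<alpha> [^]\<^bsub>AutoGroup G\<^esub> Suc k = compose (carrier G) (\<lambda>u \<in> carrier G. (\<alpha> ^^ k) u) \<alpha>"
      by (simp only: AutoGroup_def BijGroup_def monoid.simps partial_object.update_convs restrict_apply if_True)
    also have "\<dots> = (\<lambda>u \<in> carrier G. (\<alpha> ^^ Suc k) u)"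
      unfolding compose_def by (rule restrict_ext) (simp add: funpow_swap1)
    finally show ?case .
  qed
  have "\<alpha> [^]\<^bsub>AutoGroup G\<^esub> p = \<one>\<^bsub>AutoGroup G\<^esub>"
    unfolding pow by (auto simp: AutoGroup_def BijGroup_def iter_p cong: restrict_cong)
  then have "A.ord \<alpha> dvd p" using A.pow_eq_id[OF carr] by simp
  moreover have "\<alpha> \<noteq> \<one>\<^bsub>AutoGroup G\<^esub>"
  proof
    assume "\<alpha> = \<one>\<^bsub>AutoGroup G\<^esub>"
    then have "\<alpha> w = w" using nontriv by (simp add: AutoGroup_def BijGroup_def)
    then show False using nontriv closed by (simp add: \<alpha>_def)
  qed
  then have "A.ord \<alpha> \<noteq> 1" using A.ord_eq_1[OF carr] by simp
  ultimately show "A.ord \<alpha> = p" using p by (metis prime_nat_iff)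
qed

text \<open>The function \<open>e\<close> lifts the homomorphism from \<open>G\<close> onto
  \<open>G / M\<close>, identified with the integers modulo \<open>p\<close> by sending
  \<open>g\<close> to 1; being a lift, it is additive only modulo \<open>p\<close>.\<close>

lemma (in group) prime_index_exponent:
  assumes "M \<lhd> G" "finite (carrier G)" "order G = p * card M" "Factorial_Ring.prime (p::nat)"
    and "g \<in> carrier G" "g \<notin> M"
  obtains e :: "'a \<Rightarrow> int" where
    "\<And>u. u \<in> carrier G \<Longrightarrow> inv (g [^] e u) \<otimes> u \<in> M"
    "\<And>u v. \<lbrakk>u \<in> carrier G; v \<in> carrier G\<rbrakk> \<Longrightarrow> int p dvd e (u \<otimes> v) - (e u + e v)"
    "\<And>u. u \<in> M \<Longrightarrow> int p dvd e u" "int p dvd e g - 1"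
proof -
  interpret M: normal M G by fact
  have ex: "\<exists>i::int. inv (g [^] i) \<otimes> u \<in> M" if u: "u \<in> carrier G" for u
  proof -
    obtain i :: nat and b where "b \<in> M" "u = g [^] i \<otimes> b"
      using prime_index_decomp[OF assms(1) subgroup_self M.subset assms(2)
          assms(3)[unfolded order_def] assms(4) u assms(5,6)] by blast
    then have "inv (g [^] int i) \<otimes> u \<in> M" using assms by (simp add: int_pow_int)
    then show ?thesis by blast
  qed
  have gp: "g [^] p \<in> M"
    using prime_index_pow[OF assms(1) subgroup_self M.subset assms(2)] assms by (simp add: order_def)
  \<comment> \<open>Two exponents of one element differ by the exponent of a power of
    \<open>g\<close> in \<open>M\<close>, hence by a multiple of \<open>p\<close>.\<close>
  have uniq: "int p dvd i - j"
    if "inv (g [^] i) \<otimes> u \<in> M" "inv (g [^] j) \<otimes> u \<in> M" "u \<in> carrier G" for i j :: int and u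
  proof -
    have "inv (g [^] j) \<otimes> u \<otimes> inv (inv (g [^] i) \<otimes> u) \<in> M" using that by blast
    also have "inv (g [^] j) \<otimes> u \<otimes> inv (inv (g [^] i) \<otimes> u) = inv (g [^] j) \<otimes> g [^] i"
      using that assms by (simp add: m_assoc inv_mult_group)
    also have "\<dots> = g [^] (i - j)"
      using assms by (simp add: int_pow_mult[symmetric] int_pow_neg[symmetric])
    finally show ?thesis using int_pow_mem_prime assms gp M.is_subgroup by blast
  qed
  define e where "e u = (SOME i::int. inv (g [^] i) \<otimes> u \<in> M)" for u
  have e: "inv (g [^] e u) \<otimes> u \<in> M" if "u \<in> carrier G" for u
    unfolding e_def using someI_ex[OF ex[OF that]] .
  show ?thesis
  proof (rule that[of e])
    fix u v assume uv: "u \<in> carrier G" "v \<in> carrier G"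
    let ?a = "g [^] e u" and ?b = "g [^] e v"
    have "inv (g [^] (e u + e v)) \<otimes> (u \<otimes> v)
        = (inv ?b \<otimes> (inv ?a \<otimes> u) \<otimes> ?b) \<otimes> (inv ?b \<otimes> v)"
      using uv assms by (simp add: int_pow_mult m_assoc inv_mult_group)
    also have "\<dots> \<in> M"
      by (rule M.m_closed[OF normal_conj_closed[OF assms(1) e[OF uv(1)]] e[OF uv(2)]])
        (use assms(5) in simp)
    finally show "int p dvd e (u \<otimes> v) - (e u + e v)"
      using uniq[OF e] uv by simp
  next
    fix u assume "u \<in> M"
    then show "int p dvd e u" using uniq[OF e, of u 0] M.mem_carrier by simp
  next
    show "int p dvd e g - 1" using uniq[OF e, of g 1] assms by simp
  qed (fact e)
qed

text \<open>This identity for triangular numbers makes the exponent of \<open>z\<close> in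
  \<open>prime_index_auto\<close> compatible with products.\<close>

lemma triangular_add:
  fixes i j :: int
  shows "(i + j) * (i + j - 1) div 2 = i * (i - 1) div 2 + j * (j - 1) div 2 + i * j"
proof -
  have "even (i * (i - 1))" "even (j * (j - 1))" by simp_all
  then obtain a b where "i * (i - 1) = 2 * a" "j * (j - 1) = 2 * b" by (metis evenE)
  moreover from this have "(i + j) * (i + j - 1) = 2 * (a + b + i * j)"
    by (simp add: algebra_simps)
  ultimately show ?thesis by simp
qed

text \<open>Twice the difference is \<open>(i - j) * (i + j - 1)\<close>, and 2 is invertible modulo
  the odd \<open>p\<close>.\<close>

lemma triangular_cong:
  fixes i j p :: int
  assumes "odd p" "p dvd i - j"
  shows "p dvd i * (i - 1) div 2 - j * (j - 1) div 2"
proof -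
  have "even (i * (i - 1))" "even (j * (j - 1))" by simp_all
  then have "2 * (i * (i - 1) div 2 - j * (j - 1) div 2) = (i - j) * (i + j - 1)"
    by (simp add: algebra_simps)
  then have "p dvd 2 * (i * (i - 1) div 2 - j * (j - 1) div 2)" using assms(2) by simp
  moreover have "coprime p 2" using assms(1) by simp
  ultimately show ?thesis using coprime_dvd_mult_right_iff by blast
qed

text \<open>Since \<open>z\<close> is central, conjugation by \<open>g [^] i\<close> turns
  \<open>x\<close> into \<open>x \<otimes> z [^] i\<close>, and conjugation by \<open>m\<close>
  changes nothing; the power \<open>j\<close> is then taken.\<close>

lemma (in group) commutator_central_mult:
  assumes "x \<in> carrier G" "z \<in> group_center G" "g \<in> carrier G" "m \<in> carrier G"
    and "commutator x g = z" "x \<otimes> m = m \<otimes> x"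
  shows "inv (g [^] (i::int) \<otimes> m) \<otimes> x [^] (j::int) \<otimes> (g [^] i \<otimes> m) = x [^] j \<otimes> z [^] (i * j)"
proof -
  have z: "z \<in> carrier G" "\<And>u. u \<in> carrier G \<Longrightarrow> z \<otimes> u = u \<otimes> z"
    using assms(2) by (auto simp: group_center_def)
  have zi: "z [^] i \<otimes> u = u \<otimes> z [^] i" if "u \<in> carrier G" for u and i :: int
    using z that by (intro int_pow_commutes)
  have "commutator x (g [^] i) = z [^] i"
    using assms z by (metis commutator_int_pow_right)
  moreover have "commutator x m = \<one>" using assms by (simp add: commutator_eq_one_iff)
  ultimately have "commutator x (g [^] i \<otimes> m) = z [^] i"
    using assms z zi[of m i] by (simp add: commutator_mult_right m_assoc)
  then have "inv (g [^] i \<otimes> m) \<otimes> x \<otimes> (g [^] i \<otimes> m) = x \<otimes> z [^] i"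
    using assms by (simp only: conj_eq_commutator m_closed int_pow_closed)
  then have "inv (g [^] i \<otimes> m) \<otimes> x [^] j \<otimes> (g [^] i \<otimes> m) = (x \<otimes> z [^] i) [^] j"
    using assms by (subst conj_int_pow) auto
  also have "\<dots> = x [^] j \<otimes> (z [^] i) [^] j"
    using assms z zi[of x i] by (intro int_pow_mult_distrib) auto
  finally show ?thesis using z by (simp add: int_pow_pow)
qed

text \<open>The crossed homomorphism is \<open>g\<^sup>i m \<mapsto> x\<^sup>i z\<^sup>t\<close> with \<open>z = [x, g]\<close> and \<open>t = i (i - 1) / 2\<close>; it depends only
  on \<open>i\<close> modulo \<open>p\<close> because \<open>p\<close> is odd.\<close>

lemma (in group) prime_index_auto:
  assumes p: "Factorial_Ring.prime (p::nat)" "odd p"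
    and M: "M \<lhd> G" "finite (carrier G)" "order G = p * card M"
    and g: "g \<in> carrier G" "g \<notin> M"
    and x: "x \<in> M" "x [^] p = \<one>" "x \<noteq> \<one>" "\<And>m. m \<in> M \<Longrightarrow> x \<otimes> m = m \<otimes> x"
    and cent: "commutator x g \<in> group_center G"
  shows "\<exists>\<alpha> \<in> auto G. group.ord (AutoGroup G) \<alpha> = p \<and> (\<forall>m \<in> M. \<alpha> m = m) \<and> \<alpha> g = g \<otimes> x"
proof -
  interpret M: normal M G by fact
  obtain e :: "'a \<Rightarrow> int" where e:
    "\<And>u. u \<in> carrier G \<Longrightarrow> inv (g [^] e u) \<otimes> u \<in> M"
    "\<And>u v. \<lbrakk>u \<in> carrier G; v \<in> carrier G\<rbrakk> \<Longrightarrow> int p dvd e (u \<otimes> v) - (e u + e v)"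
    "\<And>u. u \<in> M \<Longrightarrow> int p dvd e u" "int p dvd e g - 1"
    using prime_index_exponent[OF M p(1) g] by metis
  define z where "z = commutator x g"
  define T where "T i = i * (i - 1) div 2" for i :: int
  have xc: "x \<in> carrier G" using x M.mem_carrier by blast
  have zc: "z \<in> carrier G" and zcomm: "\<And>u. u \<in> carrier G \<Longrightarrow> z \<otimes> u = u \<otimes> z"
    using cent by (auto simp: group_center_def z_def)
  have zM: "z \<in> M" unfolding z_def using x g M by (intro normal_commutator)
  have zi: "z [^] i \<otimes> u = u \<otimes> z [^] i" if "u \<in> carrier G" for u and i :: int
    using zc zcomm that by (intro int_pow_commutes)
  \<comment> \<open>As \<open>z\<close> is central, \<open>z [^] p\<close> is the commutator of
    \<open>x [^] p = \<one>\<close> with \<open>g\<close>.\<close>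
  have "commutator (x [^] int p) g = z [^] int p"
    unfolding z_def using xc g zcomm by (intro commutator_int_pow_left) (auto simp: z_def)
  then have zp: "z [^] p = \<one>"
    using x g by (simp add: int_pow_int commutator_def)
  define \<delta> where "\<delta> u = x [^] e u \<otimes> z [^] T (e u)" for u
  have \<delta>_eq: "\<delta> u = x [^] i \<otimes> z [^] T i" if "int p dvd e u - i" for u i
    unfolding \<delta>_def T_def
    using that int_pow_cong[OF xc x(2)] int_pow_cong[OF zc zp triangular_cong] p
    by (metis even_of_nat_iff)
  have \<delta>M: "\<delta> u \<in> M" for u
    unfolding \<delta>_def using x zM by (intro M.m_closed subgroup_int_pow_closed[OF M.is_subgroup])
  have \<delta>_on_M: "\<delta> m = \<one>" if "m \<in> M" for m
    using \<delta>_eq[of m 0] e(3)[OF that] xc zc by (simp add: T_def)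
  have \<delta>g: "\<delta> g = x" using \<delta>_eq[OF e(4)] xc zc by (simp add: T_def)
  have crossed: "\<delta> (u \<otimes> v) = inv v \<otimes> \<delta> u \<otimes> v \<otimes> \<delta> v"
    if uv: "u \<in> carrier G" "v \<in> carrier G" for u v
  proof -
    let ?i = "e u" and ?j = "e v"
    define m where "m = inv (g [^] ?j) \<otimes> v"
    have m: "m \<in> M" unfolding m_def using e(1) uv by simp
    have v: "v = g [^] ?j \<otimes> m" unfolding m_def using uv g by simp
    have "inv (g [^] ?j \<otimes> m) \<otimes> x [^] ?i \<otimes> (g [^] ?j \<otimes> m) = x [^] ?i \<otimes> z [^] (?j * ?i)"
      using m g(1) x(4) xc cent by (intro commutator_central_mult) (simp_all add: z_def)
    then have xv: "inv v \<otimes> x [^] ?i \<otimes> v = x [^] ?i \<otimes> z [^] (?j * ?i)"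
      unfolding v[symmetric] .
    \<comment> \<open>The exponents of \<open>z\<close> add up to
      \<open>T ?i + T ?j + ?j * ?i\<close>, which is \<open>T (?i + ?j)\<close>.\<close>
    have "inv v \<otimes> \<delta> u \<otimes> v \<otimes> \<delta> v = (inv v \<otimes> x [^] ?i \<otimes> v) \<otimes> (z [^] T ?i \<otimes> \<delta> v)"
      using uv xc zc zi[of v "T ?i"] by (simp add: \<delta>_def m_assoc)
    also have "\<dots> = x [^] ?i \<otimes> ((z [^] (?j * ?i + T ?i) \<otimes> x [^] ?j) \<otimes> z [^] T ?j)"
      using uv xc zc unfolding xv by (simp add: \<delta>_def m_assoc int_pow_mult)
    also have "\<dots> = x [^] (?i + ?j) \<otimes> z [^] T (?i + ?j)"
      using uv xc zc unfolding zi[OF int_pow_closed[OF xc]]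
      by (simp add: m_assoc int_pow_mult[symmetric] T_def triangular_add)
        (simp add: int_pow_mult[symmetric] m_assoc[symmetric] algebra_simps)
    also have "\<dots> = \<delta> (u \<otimes> v)" using \<delta>_eq[OF e(2)[OF uv]] by simp
    finally show ?thesis by simp
  qed
  have \<delta>p: "\<delta> u [^] p = \<one>" for u
  proof -
    have "\<delta> u [^] p = (x [^] e u) [^] p \<otimes> (z [^] T (e u)) [^] p"
      unfolding \<delta>_def using xc zc by (intro pow_mult_distrib) (auto simp: zi)
    also have "\<dots> = \<one>"
      using x zp xc zc by (metis int_pow_int int_pow_pow int_pow_one mult.commute r_one one_closed)
    finally show ?thesis .
  qed
  let ?\<alpha> = "\<lambda>u \<in> carrier G. u \<otimes> \<delta> u"
  have "?\<alpha> \<in> auto G" "group.ord (AutoGroup G) ?\<alpha> = p"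
    using \<delta>M M.mem_carrier \<delta>_on_M crossed \<delta>p g \<delta>g x p
    by (intro crossed_hom_auto[where w = g]; simp)+
  moreover have "\<forall>m \<in> M. ?\<alpha> m = m" using \<delta>_on_M M.mem_carrier by simp
  moreover have "?\<alpha> g = g \<otimes> x" using g \<delta>g by simp
  ultimately show ?thesis by blast
qed

section \<open>Automorphisms from a Heisenberg quotient\<close>

lemma (in group_hom) hom_commutator:
  assumes "a \<in> carrier G" "b \<in> carrier G"
  shows "h (G.commutator a b) = H.commutator (h a) (h b)"
  using assms by (simp add: G.commutator_def H.commutator_def)

text \<open>Moving \<open>h [^] j\<close> past \<open>g [^] i'\<close> costs
  \<open>k [^] (i' * j)\<close>; this is multiplication in the Heisenberg group in
  coordinates.\<close>

lemma (in group) class2_normal_form_mult: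
  fixes i j l i' j' l' :: int
  assumes "h \<in> carrier G" "g \<in> carrier G" "commutator h g = k"
    and "k \<otimes> h = h \<otimes> k" "k \<otimes> g = g \<otimes> k"
  shows "(g [^] i \<otimes> h [^] j \<otimes> k [^] l) \<otimes> (g [^] i' \<otimes> h [^] j' \<otimes> k [^] l')
    = g [^] (i + i') \<otimes> h [^] (j + j') \<otimes> k [^] (l + l' + i' * j)"
proof -
  have k: "k \<in> carrier G" using assms by auto
  have comm: "k [^] l \<otimes> (a [^] i \<otimes> b) = a [^] i \<otimes> (k [^] l \<otimes> b)"
    if "a \<otimes> k = k \<otimes> a" "a \<in> carrier G" "b \<in> carrier G" for a b and l i :: int
  proof -
    have "a [^] i \<otimes> k = k \<otimes> a [^] i" using that k by (intro int_pow_commutes)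
    then have "k [^] l \<otimes> a [^] i = a [^] i \<otimes> k [^] l"
      using that k by (intro int_pow_commutes) auto
    then show ?thesis using that k by (simp flip: m_assoc)
  qed
  have hg: "h [^] j \<otimes> (g [^] i' \<otimes> b) = g [^] i' \<otimes> (h [^] j \<otimes> (k [^] (i' * j) \<otimes> b))"
    if "b \<in> carrier G" for b
    using commutator_int_pow_both[of h g j i'] that assms k by (simp flip: m_assoc)
  have "(g [^] i \<otimes> h [^] j \<otimes> k [^] l) \<otimes> (g [^] i' \<otimes> h [^] j' \<otimes> k [^] l')
      = g [^] i \<otimes> (g [^] i' \<otimes> (h [^] j \<otimes> (h [^] j' \<otimes> (k [^] (i' * j) \<otimes> (k [^] l \<otimes> k [^] l')))))"
    using assms k by (simp add: m_assoc comm[of g] comm[of h] hg)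
  also have "\<dots> = g [^] (i + i') \<otimes> h [^] (j + j') \<otimes> k [^] (i' * j + (l + l'))"
    using assms k by (simp add: m_assoc int_pow_mult)
  finally show ?thesis by (simp add: algebra_simps)
qed

text \<open>The crossed homomorphism is \<open>g\<^sup>i h\<^sup>j k\<^sup>l m \<mapsto> x\<^sup>j z\<^sup>l\<close> for \<open>m \<in> N\<close>, with \<open>z = [x, g]\<close>. The hypotheses
  say that \<open>G / N\<close> is the Heisenberg group of order \<open>p\<^sup>3\<close> and exponent \<open>p\<close>.\<close>

lemma (in group) heisenberg_auto:
  assumes p: "Factorial_Ring.prime (p::nat)" and N: "N \<lhd> G"
    and gh: "g \<in> carrier G" "h \<in> carrier G" and k: "k = commutator h g"
    and decomp: "\<And>u. u \<in> carrier G \<Longrightarrow>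
      \<exists>(i::int) (j::int) (l::int). inv (g [^] i \<otimes> h [^] j \<otimes> k [^] l) \<otimes> u \<in> N"
    and indep: "\<And>(i::int) (j::int) (l::int). g [^] i \<otimes> h [^] j \<otimes> k [^] l \<in> N \<Longrightarrow>
      int p dvd i \<and> int p dvd j \<and> int p dvd l"
    and kN: "commutator k g \<in> N" "commutator k h \<in> N"
    and x: "x \<in> N" "x [^] p = \<one>" "x \<noteq> \<one>"
    and comm: "x \<otimes> h = h \<otimes> x" "x \<otimes> k = k \<otimes> x" "\<And>m. m \<in> N \<Longrightarrow> x \<otimes> m = m \<otimes> x"
    and cent: "commutator x g \<in> group_center G"
  shows "\<exists>\<alpha> \<in> auto G. group.ord (AutoGroup G) \<alpha> = p \<and> (\<forall>m \<in> N. \<alpha> m = m) \<and> \<alpha> h = h \<otimes> x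
    \<and> (\<forall>u \<in> carrier G. \<exists>i j::int. \<alpha> u = u \<otimes> (x [^] (i::int) \<otimes> commutator x g [^] j))"
proof -
  interpret N: normal N G by fact
  interpret Q: group "G Mod N" by (rule N.factorgroup_is_group)
  interpret \<pi>: group_hom G "G Mod N" "\<lambda>u. N #> u"
    using N.r_coset_hom_Mod by unfold_locales
  define z where "z = commutator x g"
  define w where "w i j l = g [^] i \<otimes> h [^] j \<otimes> k [^] l" for i j l :: int
  \<comment> \<open>\<open>R u i j l\<close> says that \<open>u\<close> has the coordinates
    \<open>i\<close>, \<open>j\<close>, \<open>l\<close> modulo \<open>N\<close>.\<close>
  define R where "R u i j l \<longleftrightarrow> inv (w i j l) \<otimes> u \<in> N" for u i j l
  have kc: "k \<in> carrier G" using k gh by simp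
  have wc: "w i j l \<in> carrier G" for i j l using gh kc by (simp add: w_def)
  have \<pi>_one: "N #> u = N \<longleftrightarrow> u \<in> N" if "u \<in> carrier G" for u
    using that by (metis N.is_subgroup coset_join1 coset_join2 N.subset)
  have R_iff: "R u i j l \<longleftrightarrow> N #> u = N #> w i j l" if u: "u \<in> carrier G" for u i j l
  proof -
    have "R u i j l \<longleftrightarrow> inv\<^bsub>G Mod N\<^esub> (N #> w i j l) \<otimes>\<^bsub>G Mod N\<^esub> (N #> u) = \<one>\<^bsub>G Mod N\<^esub>"
      unfolding R_def using \<pi>_one[of "inv (w i j l) \<otimes> u"] wc u
      by (simp only: \<pi>.hom_mult \<pi>.hom_inv inv_closed m_closed one_FactGroup)
    also have "\<dots> \<longleftrightarrow> N #> u = N #> w i j l"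
      using wc u \<pi>.hom_closed by (metis Q.inv_closed Q.inv_equality Q.inv_inv Q.l_inv)
    finally show ?thesis .
  qed
  have \<pi>_w: "N #> w i j l = (N #> g) [^]\<^bsub>G Mod N\<^esub> i \<otimes>\<^bsub>G Mod N\<^esub> (N #> h) [^]\<^bsub>G Mod N\<^esub> j
      \<otimes>\<^bsub>G Mod N\<^esub> (N #> k) [^]\<^bsub>G Mod N\<^esub> l" for i j l
    unfolding w_def using gh kc by (simp only: \<pi>.hom_mult \<pi>.hom_int_pow m_closed int_pow_closed)
  have R_mult: "R (u \<otimes> v) (i + i') (j + j') (l + l' + i' * j)"
    if "R u i j l" "R v i' j' l'" "u \<in> carrier G" "v \<in> carrier G" for u v i j l i' j' l'
  proof -
    have "N #> (u \<otimes> v) = (N #> w i j l) \<otimes>\<^bsub>G Mod N\<^esub> (N #> w i' j' l')"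
      using that by (simp only: \<pi>.hom_mult R_iff)
    also have "\<dots> = N #> w (i + i') (j + j') (l + l' + i' * j)"
      unfolding \<pi>_w
    proof (rule Q.class2_normal_form_mult)
      show "N #> h \<in> carrier (G Mod N)" "N #> g \<in> carrier (G Mod N)" using gh \<pi>.hom_closed by auto
      show "Q.commutator (N #> h) (N #> g) = N #> k"
        using \<pi>.hom_commutator[of h g] gh k by simp
      show "(N #> k) \<otimes>\<^bsub>G Mod N\<^esub> (N #> h) = (N #> h) \<otimes>\<^bsub>G Mod N\<^esub> (N #> k)"
        "(N #> k) \<otimes>\<^bsub>G Mod N\<^esub> (N #> g) = (N #> g) \<otimes>\<^bsub>G Mod N\<^esub> (N #> k)"
        using Mod_commute_iff[OF N kc] gh kN by blast+
    qed
    finally show ?thesis using that by (simp only: R_iff m_closed)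
  qed
  have ex: "\<exists>i j l. R u i j l" if "u \<in> carrier G" for u
    using decomp[OF that] by (simp add: R_def w_def)
  have uniq1: "int p dvd i \<and> int p dvd j \<and> int p dvd l" if "R \<one> i j l" for i j l
  proof -
    have "inv (w i j l) \<in> N" using that wc by (simp add: R_def)
    then have "inv (inv (w i j l)) \<in> N" by (rule N.m_inv_closed)
    then show ?thesis using indep wc by (simp add: w_def)
  qed
  \<comment> \<open>Multiplying by \<open>inv u\<close> reduces uniqueness to the coordinates of
    \<open>\<one>\<close>; the term \<open>a * j\<close> is why the second coordinate is settled
    before the third.\<close>
  have uniq: "int p dvd j - j'" "int p dvd l - l'"
    if r: "R u i j l" "R u i' j' l'" and u: "u \<in> carrier G" for u i j l i' j' l'
  proof -
    obtain a b c where abc: "R (inv u) a b c" using ex[OF inv_closed[OF u]] by blast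
    have "R \<one> (i + a) (j + b) (l + c + a * j)" "R \<one> (i' + a) (j' + b) (l' + c + a * j')"
      using R_mult[OF r(1) abc] R_mult[OF r(2) abc] u by simp_all
    then have *: "int p dvd j + b" "int p dvd j' + b"
      "int p dvd l + c + a * j" "int p dvd l' + c + a * j'"
      using uniq1 by blast+
    have "j - j' = (j + b) - (j' + b)" by simp
    then show j: "int p dvd j - j'" using * by (metis dvd_diff)
    have "l - l' = (l + c + a * j) - (l' + c + a * j') - a * (j - j')" by (simp add: algebra_simps)
    then show "int p dvd l - l'" using * j by (metis dvd_diff dvd_mult)
  qed
  obtain e1 e2 e3 where e: "\<And>u. u \<in> carrier G \<Longrightarrow> R u (e1 u) (e2 u) (e3 u)"
    using ex by metis
  have xc: "x \<in> carrier G" using x N.mem_carrier by blast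
  have zc: "z \<in> carrier G" and zcomm: "\<And>u. u \<in> carrier G \<Longrightarrow> z \<otimes> u = u \<otimes> z"
    using cent by (auto simp: group_center_def z_def)
  have zN: "z \<in> N" unfolding z_def using x gh N by (intro normal_commutator)
  have zi: "z [^] i \<otimes> u = u \<otimes> z [^] i" if "u \<in> carrier G" for u and i :: int
    using zc zcomm that by (intro int_pow_commutes)
  have "commutator (x [^] int p) g = z [^] int p"
    unfolding z_def using xc gh zcomm by (intro commutator_int_pow_left) (auto simp: z_def)
  then have zp: "z [^] p = \<one>"
    using x gh by (simp add: int_pow_int commutator_def)
  define \<delta> where "\<delta> u = x [^] e2 u \<otimes> z [^] e3 u" for u
  have \<delta>_eq: "\<delta> u = x [^] j \<otimes> z [^] l" if "R u i j l" "u \<in> carrier G" for u i j l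
    unfolding \<delta>_def
    using int_pow_cong[OF xc x(2)] int_pow_cong[OF zc zp] uniq[OF e[OF that(2)] that] by simp
  have \<delta>N: "\<delta> u \<in> N" for u
    unfolding \<delta>_def using x(1) zN subgroup_int_pow_closed[OF N.is_subgroup] by (simp add: N.m_closed)
  have \<delta>_on_N: "\<delta> m = \<one>" if "m \<in> N" for m
    using \<delta>_eq[of m 0 0 0] that xc zc gh kc N.mem_carrier by (simp add: R_def w_def)
  have "R h 0 1 0" using gh kc by (simp add: R_def w_def)
  then have \<delta>h: "\<delta> h = x" using \<delta>_eq xc zc gh by simp
  have crossed: "\<delta> (u \<otimes> v) = inv v \<otimes> \<delta> u \<otimes> v \<otimes> \<delta> v"
    if uv: "u \<in> carrier G" "v \<in> carrier G" for u v
  proof -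
    obtain i j l where u: "R u i j l" using ex uv by blast
    obtain i' j' l' where v: "R v i' j' l'" using ex uv by blast
    define m where "m = inv (w i' j' l') \<otimes> v"
    \<comment> \<open>Everything in \<open>v\<close> after \<open>g [^] i'\<close> commutes with
      \<open>x\<close>, as \<open>commutator_central_mult\<close> requires.\<close>
    define b where "b = h [^] j' \<otimes> k [^] l' \<otimes> m"
    have m: "m \<in> N" "m \<in> carrier G" using v uv wc by (auto simp: m_def R_def)
    have "x \<otimes> h [^] j' = h [^] j' \<otimes> x" "x \<otimes> k [^] l' = k [^] l' \<otimes> x" "x \<otimes> m = m \<otimes> x"
      using int_pow_commutes[of h x j'] int_pow_commutes[of k x l'] comm gh kc xc m by auto
    then have xb: "x \<otimes> b = b \<otimes> x"
      unfolding b_def using m gh kc xc by (metis int_pow_closed m_assoc m_closed)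
    have bc: "b \<in> carrier G" using m gh kc by (simp add: b_def)
    have v_eq: "g [^] i' \<otimes> b = v" using uv gh kc wc by (simp add: b_def m_def w_def m_assoc inv_mult_group)
    have "inv (g [^] i' \<otimes> b) \<otimes> x [^] j \<otimes> (g [^] i' \<otimes> b) = x [^] j \<otimes> z [^] (i' * j)"
      using gh xc bc xb cent by (intro commutator_central_mult) (simp_all add: z_def)
    then have xv: "inv v \<otimes> x [^] j \<otimes> v = x [^] j \<otimes> z [^] (i' * j)"
      unfolding v_eq .
    have \<delta>u: "\<delta> u = x [^] j \<otimes> z [^] l" and \<delta>v: "\<delta> v = x [^] j' \<otimes> z [^] l'"
      using \<delta>_eq u v uv by auto
    have "inv v \<otimes> \<delta> u \<otimes> v \<otimes> \<delta> v = (inv v \<otimes> x [^] j \<otimes> v) \<otimes> (z [^] l \<otimes> \<delta> v)"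
      using uv xc zc zi[of v l] by (simp add: \<delta>u \<delta>v m_assoc)
    also have "\<dots> = x [^] j \<otimes> ((z [^] (i' * j + l) \<otimes> x [^] j') \<otimes> z [^] l')"
      using uv xc zc unfolding xv by (simp add: \<delta>v m_assoc int_pow_mult)
    also have "\<dots> = x [^] (j + j') \<otimes> z [^] ((i' * j + l) + l')"
      using uv xc zc unfolding zi[OF int_pow_closed[OF xc]] by (simp add: int_pow_mult m_assoc)
    \<comment> \<open>The exponent of \<open>z\<close> is thus the third coordinate of
      \<open>u \<otimes> v\<close> given by \<open>R_mult\<close>.\<close>
    also have "(i' * j + l) + l' = l + l' + i' * j" by simp
    also have "x [^] (j + j') \<otimes> z [^] (l + l' + i' * j) = \<delta> (u \<otimes> v)"
      using \<delta>_eq[OF R_mult[OF u v uv]] uv by simp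
    finally show ?thesis by simp
  qed
  have \<delta>p: "\<delta> u [^] p = \<one>" for u
  proof -
    have "\<delta> u [^] p = (x [^] e2 u) [^] p \<otimes> (z [^] e3 u) [^] p"
      unfolding \<delta>_def using xc zc by (intro pow_mult_distrib) (auto simp: zi)
    also have "\<dots> = \<one>"
      using x zp xc zc by (metis int_pow_int int_pow_pow int_pow_one mult.commute r_one one_closed)
    finally show ?thesis .
  qed
  let ?\<alpha> = "\<lambda>u \<in> carrier G. u \<otimes> \<delta> u"
  have "?\<alpha> \<in> auto G" "group.ord (AutoGroup G) ?\<alpha> = p"
    using \<delta>N N.mem_carrier \<delta>_on_N crossed \<delta>p gh \<delta>h x p
    by (intro crossed_hom_auto[where w = h]; simp)+
  moreover have "\<forall>m \<in> N. ?\<alpha> m = m" using \<delta>_on_N N.mem_carrier by simp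
  moreover have "?\<alpha> h = h \<otimes> x" using gh \<delta>h by simp
  moreover have "\<exists>i j::int. ?\<alpha> u = u \<otimes> (x [^] (i::int) \<otimes> commutator x g [^] j)"
    if "u \<in> carrier G" for u
    using that by (auto simp: \<delta>_def z_def)
  ultimately show ?thesis by blast
qed

section \<open>Normality, maximal subgroups and subgroups of index p\<close>

lemma (in group) normalI_commutator:
  assumes "subgroup M G" "\<And>a u. \<lbrakk>a \<in> M; u \<in> carrier G\<rbrakk> \<Longrightarrow> commutator a u \<in> M"
  shows "M \<lhd> G"
proof (rule normal_invI[OF assms(1)])
  fix u m assume u: "u \<in> carrier G" and m: "m \<in> M"
  then have "u \<otimes> m \<otimes> inv u = m \<otimes> commutator m (inv u)"
    using conj_eq_commutator[of m "inv u"] subgroup.mem_carrier[OF assms(1)] by simp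
  then show "u \<otimes> m \<otimes> inv u \<in> M"
    using assms u m by (simp add: subgroup.m_closed)
qed

lemma (in group) card_subgroup_dvd:
  assumes "subgroup H G" "subgroup K G" "H \<subseteq> K"
  shows "card H dvd card K"
proof -
  interpret K: group "G\<lparr>carrier := K\<rparr>" using assms(2) by (rule subgroup_imp_group)
  have "subgroup H (G\<lparr>carrier := K\<rparr>)"
    using assms by (simp add: subgroup_incl)
  from K.lagrange[OF this] have "card K = card (rcosets\<^bsub>G\<lparr>carrier := K\<rparr>\<^esub> H) * card H"
    by (simp add: order_def)
  then show ?thesis by simp
qed

text \<open>The order of a subgroup between \<open>M\<close> and \<open>G\<close> is
  \<open>card M\<close> times a divisor of the prime \<open>p\<close>.\<close>

lemma (in group) maximal_subgroupI:
  assumes "subgroup M G" "order G = p * card M" "Factorial_Ring.prime (p::nat)" "finite (carrier G)"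
  shows "maximal_subgroup M G"
  unfolding maximal_subgroup_def
proof (intro conjI allI impI)
  have sub: "M \<subseteq> carrier G" using assms(1) by (rule subgroup.subset)
  then have fM: "finite M" using assms(4) by (rule finite_subset)
  have cM: "card M > 0" unfolding card_gt_0_iff using fM subgroup.one_closed[OF assms(1)] by blast
  show "subgroup M G" by fact
  show "M \<noteq> carrier G"
    using assms(2,3) cM by (auto simp: order_def)
  fix H assume H: "subgroup H G \<and> M \<subseteq> H"
  then have Hc: "H \<subseteq> carrier G" by (simp add: subgroup.subset)
  then have fH: "finite H" using assms(4) by (rule finite_subset)
  obtain a where a: "card H = card M * a" using card_subgroup_dvd[OF assms(1)] H by blast
  have "card H dvd order G" using card_subgroup_dvd[OF _ subgroup_self] H Hc by (simp add: order_def)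
  then have "a dvd p" using a cM assms(2) by simp
  then have "a = 1 \<or> a = p" using assms(3) by (simp add: prime_nat_iff)
  then show "H = M \<or> H = carrier G"
  proof
    assume "a = 1"
    then show ?thesis using a H fH by (metis card_subset_eq mult.right_neutral)
  next
    assume "a = p"
    then have "card H = card (carrier G)" using a assms(2) by (simp add: order_def mult.commute)
    then show ?thesis using Hc assms(4) by (metis card_subset_eq)
  qed
qed

text \<open>Sylow's theorem in the \<open>p\<close>-group \<open>G Mod D\<close> gives a subgroup of
  index \<open>p\<close>, whose preimage is \<open>M\<close>.\<close>

lemma (in group) exists_subgroup_prime_index:
  assumes "Factorial_Ring.prime (p::nat)" "order G = p ^ n" "D \<lhd> G" "D \<noteq> carrier G"
  shows "\<exists>M. subgroup M G \<and> D \<subseteq> M \<and> order G = p * card M"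
proof -
  interpret D: normal D G by fact
  interpret Q: group "G Mod D" by (rule D.factorgroup_is_group)
  have "order G > 0" using assms by (simp add: prime_gt_0_nat)
  then have fin: "finite (carrier G)" using order_gt_0_iff_finite by simp
  then have finD: "finite D" using D.subset by (rule rev_finite_subset)
  have cD: "card D > 0" unfolding card_gt_0_iff using D.one_closed finD by blast
  have ord: "order (G Mod D) * card D = p ^ n"
    using lagrange[OF D.is_subgroup] assms(2) by (simp add: order_def FactGroup_def)
  then obtain k where k: "order (G Mod D) = p ^ k"
    using assms(1) divides_primepow_nat by (metis dvd_triv_left)
  have "k \<noteq> 0"
  proof
    assume "k = 0"
    then have "card D = card (carrier G)" using ord k assms(2) by (simp add: order_def)
    then show False using assms(4) fin D.subset by (metis card_subset_eq)
  qed
  then obtain k' where k': "k = Suc k'" by (cases k) auto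
  have finQ: "finite (carrier (G Mod D))"
    using fin by (simp add: carrier_FactGroup)
  \<comment> \<open>The exponent \<open>k'\<close> is one less than that of the order, so the
    cofactor in Sylow's theorem is \<open>p\<close> itself.\<close>
  obtain S where S: "subgroup S (G Mod D)" "card S = p ^ k'"
    using sylow_thm[of p "G Mod D" k' p] assms(1) k k' finQ Q.is_group by auto
  define M where "M = \<Union>S"
  have M_eq: "M = {x \<in> carrier G. D #> x \<in> S}"
    unfolding M_def by (rule D.factgroup_subgroup_union_char[OF S(1)])
  have M: "subgroup M G" unfolding M_def by (rule D.factgroup_subgroup_union_subgroup[OF S(1)])
  have DM: "D \<subseteq> M"
  proof
    fix d assume "d \<in> D"
    then have "D #> d = \<one>\<^bsub>G Mod D\<^esub>" using coset_join2[OF _ D.is_subgroup] D.mem_carrier by simp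
    then show "d \<in> M" using subgroup.one_closed[OF S(1)] \<open>d \<in> D\<close> D.mem_carrier by (simp add: M_eq)
  qed
  interpret M: group "G\<lparr>carrier := M\<rparr>" using M by (rule subgroup_imp_group)
  have "subgroup D (G\<lparr>carrier := M\<rparr>)" using D.is_subgroup M DM by (rule subgroup_incl)
  from M.lagrange[OF this] have "card (rcosets\<^bsub>G\<lparr>carrier := M\<rparr>\<^esub> D) * card D = card M"
    by (simp add: order_def)
  moreover have "rcosets\<^bsub>G\<lparr>carrier := M\<rparr>\<^esub> D = S"
  proof -
    have "rcosets\<^bsub>G\<lparr>carrier := M\<rparr>\<^esub> D = (\<lambda>x. D #> x) ` M" by (auto simp: RCOSETS_def)
    also have "\<dots> = S"
    proof
      show "(\<lambda>x. D #> x) ` M \<subseteq> S" by (auto simp: M_eq)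
      show "S \<subseteq> (\<lambda>x. D #> x) ` M"
      proof
        fix X assume X: "X \<in> S"
        then have "X \<in> carrier (G Mod D)" using subgroup.subset[OF S(1)] by blast
        then obtain x where "x \<in> carrier G" "X = D #> x" unfolding carrier_FactGroup by blast
        then show "X \<in> (\<lambda>x. D #> x) ` M" using X by (simp add: M_eq)
      qed
    qed
    finally show ?thesis .
  qed
  ultimately have "p ^ k' * card D = card M" using S by simp
  then have "order G = p * card M" using ord k k' assms(2) by (metis mult.assoc power_Suc)
  then show ?thesis using M DM by blast
qed

section \<open>Finite p-groups\<close>


lemma (in group) upper_central_one: "upper_central G (Suc 0) = group_center G"
  by (auto simp: upper_central_Suc_iff group_center_def commutator_eq_one_iff)

text \<open>Here \<open>w\<close> is the inverse of the conjugating element. The form allows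
  comparison with the automorphisms built from crossed homomorphisms.\<close>

lemma (in group) inner_auto_commutator:
  assumes "\<alpha> \<in> inner_auto G"
  obtains w where "w \<in> carrier G" "\<And>u. u \<in> carrier G \<Longrightarrow> \<alpha> u = u \<otimes> commutator u w"
proof -
  obtain y where y: "y \<in> carrier G" "\<alpha> = (\<lambda>x \<in> carrier G. y \<otimes> x \<otimes> inv y)"
    using assms unfolding inner_auto_def by blast
  have "\<alpha> u = u \<otimes> commutator u (inv y)" if "u \<in> carrier G" for u
    using y that by (simp add: commutator_def m_assoc)
  then show thesis using that y(1) by blast
qed

lemma (in group) centralizer_subgroup:
  assumes "S \<subseteq> carrier G"
  shows "subgroup {u \<in> carrier G. \<forall>s \<in> S. s \<otimes> u = u \<otimes> s} G" (is "subgroup ?C G")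
proof
  show "?C \<subseteq> carrier G" "\<one> \<in> ?C" using assms by auto
next
  fix a b assume ab: "a \<in> ?C" "b \<in> ?C"
  have "s \<otimes> (a \<otimes> b) = a \<otimes> b \<otimes> s" if "s \<in> S" for s
  proof -
    have c: "a \<in> carrier G" "b \<in> carrier G" "s \<in> carrier G"
      and e: "s \<otimes> a = a \<otimes> s" "s \<otimes> b = b \<otimes> s" using ab that assms by auto
    have "s \<otimes> (a \<otimes> b) = (s \<otimes> a) \<otimes> b" using c by (simp add: m_assoc)
    also have "\<dots> = a \<otimes> (s \<otimes> b)" unfolding e(1) using c by (simp add: m_assoc)
    also have "\<dots> = a \<otimes> b \<otimes> s" unfolding e(2) using c by (simp add: m_assoc)
    finally show ?thesis .
  qed
  with ab show "a \<otimes> b \<in> ?C" by auto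
next
  fix a assume a: "a \<in> ?C"
  have "s \<otimes> inv a = inv a \<otimes> s" if "s \<in> S" for s
  proof -
    have "a \<in> carrier G" "s \<in> carrier G" "a \<otimes> s = s \<otimes> a" using a that assms by auto
    from int_pow_commutes[OF this(3,1,2), of "-1"] show ?thesis
      using \<open>a \<in> carrier G\<close> by (simp add: int_pow_neg)
  qed
  with a show "inv a \<in> ?C" by auto
qed

text \<open>Commutators of powers of \<open>g\<close> with \<open>w\<close> are products of
  conjugates of \<open>commutator g w\<close>, and factors from \<open>M\<close> add nothing; so one
  commutator decides.\<close>

lemma (in group) upper_centralI_prime_index:
  assumes "w \<in> carrier G" "g \<in> carrier G" "commutator g w \<in> upper_central G k"
    and "M \<subseteq> carrier G" "\<And>m. m \<in> M \<Longrightarrow> m \<otimes> w = w \<otimes> m"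
    and "\<And>u. u \<in> carrier G \<Longrightarrow> \<exists>i::nat. \<exists>m \<in> M. u = g [^] i \<otimes> m"
  shows "w \<in> upper_central G (Suc k)"
proof -
  interpret K: normal "upper_central G k" G by (rule normal_upper_central)
  note conj = normal_conj_closed[OF normal_upper_central]
  have pow: "commutator (g [^] i) w \<in> upper_central G k" for i :: nat
  proof (induction i)
    case 0
    then show ?case using assms(1) by (simp add: commutator_def)
  next
    case (Suc i)
    then show ?case
      using assms(1-3) by (simp add: commutator_mult_left K.m_closed conj)
  qed
  have "commutator w u \<in> upper_central G k" if u: "u \<in> carrier G" for u
  proof -
    obtain i :: nat and m where m: "m \<in> M" "u = g [^] i \<otimes> m" using assms(6)[OF u] by blast
    have mc: "m \<in> carrier G" using m assms(4) by blast
    have "commutator m w = \<one>" using assms(1,5) m mc by (simp add: commutator_eq_one_iff)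
    then have "commutator u w \<in> upper_central G k"
      unfolding m(2) using mc assms(1,2) pow by (simp add: commutator_mult_left conj)
    then have "inv (commutator u w) \<in> upper_central G k" by (rule K.m_inv_closed)
    then show ?thesis using u assms(1) by (simp add: inv_commutator)
  qed
  then show ?thesis using assms(1) by (simp add: upper_central_Suc_iff)
qed

lemma (in group) commutator_pow_Mod:
  assumes "N \<lhd> G" "a \<in> carrier G" "b \<in> carrier G" "commutator (commutator a b) a \<in> N"
  shows "commutator (a [^] (i::int)) b \<in> N \<longleftrightarrow> commutator a b [^] i \<in> N"
proof -
  interpret N: normal N G by fact
  interpret Q: group "G Mod N" by (rule N.factorgroup_is_group)
  interpret \<pi>: group_hom G "G Mod N" "\<lambda>u. N #> u"
    using N.r_coset_hom_Mod by unfold_locales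
  have \<pi>_one: "N #> u = N \<longleftrightarrow> u \<in> N" if "u \<in> carrier G" for u
    using that by (metis N.is_subgroup coset_join1 coset_join2 N.subset)
  have "N #> commutator (a [^] i) b = Q.commutator ((N #> a) [^]\<^bsub>G Mod N\<^esub> i) (N #> b)"
    using assms by (simp only: \<pi>.hom_commutator \<pi>.hom_int_pow int_pow_closed)
  also have "\<dots> = Q.commutator (N #> a) (N #> b) [^]\<^bsub>G Mod N\<^esub> i"
  proof (rule Q.commutator_int_pow_left)
    show "N #> a \<in> carrier (G Mod N)" "N #> b \<in> carrier (G Mod N)"
      using assms \<pi>.hom_closed by auto
    show "Q.commutator (N #> a) (N #> b) \<otimes>\<^bsub>G Mod N\<^esub> (N #> a)
        = (N #> a) \<otimes>\<^bsub>G Mod N\<^esub> Q.commutator (N #> a) (N #> b)"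
      using Mod_commute_iff[OF assms(1), of "commutator a b" a] assms \<pi>.hom_commutator[OF assms(2,3)]
      by simp
  qed
  also have "\<dots> = N #> commutator a b [^] i"
    using assms by (simp only: \<pi>.hom_commutator[symmetric] \<pi>.hom_int_pow commutator_closed)
  finally show ?thesis
    using \<pi>_one[of "commutator (a [^] i) b"] \<pi>_one[of "commutator a b [^] i"] assms by simp
qed

text \<open>By \<open>class2_odd_pow\<close> in \<open>G Mod N\<close>, the \<open>p\<close>-th
  power of \<open>g \<otimes> h\<close> is there the product of the \<open>p\<close>-th powers;
  since it and \<open>g [^] p\<close> become trivial, so does \<open>h [^] p\<close>.\<close>

lemma (in group) class2_odd_pow_Mod:
  assumes "N \<lhd> G" "h \<in> carrier G" "g \<in> carrier G"
    and "commutator (commutator h g) h \<in> N" "commutator (commutator h g) g \<in> N"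
    and "commutator h g [^] (p::nat) \<in> N" "odd p"
    and "g [^] p \<in> N" "(g \<otimes> h) [^] p \<in> N"
  shows "h [^] p \<in> N"
proof -
  interpret N: normal N G by fact
  interpret Q: group "G Mod N" by (rule N.factorgroup_is_group)
  interpret \<pi>: group_hom G "G Mod N" "\<lambda>u. N #> u"
    using N.r_coset_hom_Mod by unfold_locales
  have \<pi>_one: "N #> u = N \<longleftrightarrow> u \<in> N" if "u \<in> carrier G" for u
    using that by (metis N.is_subgroup coset_join1 coset_join2 N.subset)
  have \<pi>_pow: "(N #> u) [^]\<^bsub>G Mod N\<^esub> p = \<one>\<^bsub>G Mod N\<^esub> \<longleftrightarrow> u [^] p \<in> N" if "u \<in> carrier G" for u
    using \<pi>_one[of "u [^] p"] \<pi>.hom_nat_pow[OF that, of p] that by simp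
  have c: "N #> h \<in> carrier (G Mod N)" "N #> g \<in> carrier (G Mod N)"
    using assms \<pi>.hom_closed by auto
  have k: "Q.commutator (N #> h) (N #> g) = N #> commutator h g"
    using \<pi>.hom_commutator[of h g] assms by simp
  have "((N #> g) \<otimes>\<^bsub>G Mod N\<^esub> (N #> h)) [^]\<^bsub>G Mod N\<^esub> p
      = (N #> g) [^]\<^bsub>G Mod N\<^esub> p \<otimes>\<^bsub>G Mod N\<^esub> (N #> h) [^]\<^bsub>G Mod N\<^esub> p"
  proof (rule Q.class2_odd_pow[OF c])
    show "Q.commutator (N #> h) (N #> g) \<otimes>\<^bsub>G Mod N\<^esub> (N #> h)
        = (N #> h) \<otimes>\<^bsub>G Mod N\<^esub> Q.commutator (N #> h) (N #> g)"
      "Q.commutator (N #> h) (N #> g) \<otimes>\<^bsub>G Mod N\<^esub> (N #> g)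
        = (N #> g) \<otimes>\<^bsub>G Mod N\<^esub> Q.commutator (N #> h) (N #> g)"
      unfolding k using Mod_commute_iff[OF assms(1), of "commutator h g"] assms(2-5) by blast+
    show "Q.commutator (N #> h) (N #> g) [^]\<^bsub>G Mod N\<^esub> p = \<one>\<^bsub>G Mod N\<^esub>"
      unfolding k using \<pi>_pow assms by blast
  qed fact
  moreover have "(N #> g) \<otimes>\<^bsub>G Mod N\<^esub> (N #> h) = N #> (g \<otimes> h)"
    using assms by (simp only: \<pi>.hom_mult)
  ultimately have "(N #> h) [^]\<^bsub>G Mod N\<^esub> p = \<one>\<^bsub>G Mod N\<^esub>"
    using assms \<pi>_pow[of g] \<pi>_pow[of "g \<otimes> h"] c by (metis Q.l_one Q.nat_pow_closed m_closed)
  then show ?thesis using \<pi>_pow assms by blast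
qed

text \<open>A group that is cyclic modulo its center is abelian, applied to \<open>G\<close> modulo
  the \<open>k\<close>-th term.\<close>

lemma (in group) upper_central_noncyclic:
  assumes "g \<in> carrier G" "\<And>u. u \<in> carrier G \<Longrightarrow> \<exists>i::int. \<exists>b \<in> upper_central G (Suc k). u = g [^] i \<otimes> b"
  shows "upper_central G (Suc k) = carrier G"
proof -
  interpret K: normal "upper_central G k" G by (rule normal_upper_central)
  have "commutator g u \<in> upper_central G k" if u: "u \<in> carrier G" for u
  proof -
    obtain i :: int and b where b: "b \<in> upper_central G (Suc k)" "u = g [^] i \<otimes> b"
      using assms(2)[OF u] by blast
    have bc: "b \<in> carrier G" using b by (simp add: upper_central_Suc_iff)
    have "commutator g (g [^] i) = \<one>"
      using assms(1) int_pow_commutes[of g g i] by (simp add: commutator_eq_one_iff)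
    moreover have "inv (commutator b g) \<in> upper_central G k"
      using b assms(1) by (simp add: upper_central_Suc_iff)
    ultimately show ?thesis
      unfolding b(2) using bc assms(1) by (simp add: commutator_mult_right inv_commutator)
  qed
  then have g: "g \<in> upper_central G (Suc k)" using assms(1) by (simp add: upper_central_Suc_iff)
  have "u \<in> upper_central G (Suc k)" if "u \<in> carrier G" for u
    using assms(2)[OF that] g subgroup_int_pow_closed[OF subgroup_upper_central g]
      subgroup.m_closed[OF subgroup_upper_central] by blast
  then show ?thesis using subgroup.subset[OF subgroup_upper_central] by blast
qed

section \<open>Orders of subgroups in finite p-groups\<close>

locale finite_p_group = group +
  fixes p n :: nat
  assumes prime_p: "Factorial_Ring.prime p" and order_eq: "order G = p ^ n"
begin

lemma finite_carrier: "finite (carrier G)"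
  using order_gt_0_iff_finite order_eq prime_gt_0_nat[OF prime_p] by simp

lemma finite_subgroup: "subgroup H G \<Longrightarrow> finite H"
  using finite_carrier finite_subset subgroup.subset by blast

lemma card_subgroup:
  assumes "subgroup H G"
  shows "card H = p ^ multiplicity p (card H)"
proof -
  have "card H dvd p ^ n"
    using card_subgroup_dvd[OF assms subgroup_self] subgroup.subset[OF assms] order_eq
    by (simp add: order_def)
  then obtain k where "card H = p ^ k" using prime_p divides_primepow_nat by blast
  then show ?thesis using prime_p by (simp add: prime_elem_multiplicity_power_distrib)
qed

text \<open>The element is \<open>u\<close> raised to its order divided by \<open>p\<close>.\<close>

lemma exists_order_p:
  assumes "subgroup H G" "u \<in> H" "u \<noteq> \<one>"
  shows "\<exists>x \<in> H. x \<noteq> \<one> \<and> x [^] p = \<one>"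
proof -
  have uc: "u \<in> carrier G" using assms subgroup.mem_carrier by metis
  have "ord u dvd p ^ n" using ord_dvd_group_order[OF uc] order_eq by simp
  then obtain k where k: "ord u = p ^ k" using prime_p divides_primepow_nat by blast
  have "k \<noteq> 0" using k assms(3) ord_eq_1[OF uc] by (metis power_0)
  then obtain k' where k': "k = Suc k'" by (cases k) auto
  define x where "x = u [^] (p ^ k')"
  have "x \<in> H" unfolding x_def using subgroup_int_pow_closed[OF assms(1,2), of "int (p ^ k')"]
    by (simp only: int_pow_int)
  moreover have "x [^] p = \<one>"
    using pow_ord_eq_1[OF uc] k k' uc by (simp add: x_def nat_pow_pow mult.commute)
  moreover have "x \<noteq> \<one>"
  proof
    assume "x = \<one>"
    then have "p ^ k dvd p ^ k'" using pow_eq_id[OF uc, of "p ^ k'"] k by (simp add: x_def)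
    then show False using k' prime_gt_1_nat[OF prime_p] by (simp add: power_dvd_imp_le)
  qed
  ultimately show ?thesis by blast
qed

text \<open>\<open>G\<close> modulo the \<open>i\<close>-th term is a nontrivial
  \<open>p\<close>-group and so has a nontrivial center.\<close>

lemma upper_central_strict:
  assumes "upper_central G i \<noteq> carrier G"
  shows "upper_central G i \<subset> upper_central G (Suc i)"
proof -
  let ?Z = "upper_central G i"
  interpret Z: normal ?Z G by (rule normal_upper_central)
  interpret Q: group "G Mod ?Z" by (rule Z.factorgroup_is_group)
  have ord: "order (G Mod ?Z) * card ?Z = p ^ n"
    using lagrange[OF Z.is_subgroup] order_eq by (simp add: order_def FactGroup_def)
  then obtain k where k: "order (G Mod ?Z) = p ^ k"
    using prime_p divides_primepow_nat by (metis dvd_triv_left)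
  have "k \<noteq> 0"
  proof
    assume "k = 0"
    then have "card ?Z = card (carrier G)" using ord k order_eq by (simp add: order_def)
    then show False using assms finite_carrier Z.subset by (metis card_subset_eq)
  qed
  then obtain X where X: "X \<in> group_center (G Mod ?Z)" "X \<noteq> ?Z"
    using Q.p_group_center_nontrivial[OF prime_p k] by auto
  then obtain x where x: "x \<in> carrier G" "X = ?Z #> x"
    by (auto simp: group_center_def carrier_FactGroup)
  have "x \<in> upper_central G (Suc i)" using x X by (simp add: upper_central.simps(2))
  moreover have "x \<notin> ?Z" using X x coset_join2[OF x(1) Z.is_subgroup] by blast
  ultimately show ?thesis using upper_central_mono_Suc by blast
qed

text \<open>A series that is strict at every step would outgrow the finite order of
  \<open>G\<close>; thus the \<open>LEAST\<close> in \<open>nilpotency_class\<close> is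
  attained.\<close>

lemma upper_central_nilpotency_class: "upper_central G (nilpotency_class G) = carrier G"
proof -
  have "\<exists>c. upper_central G c = carrier G"
  proof (rule ccontr)
    assume *: "\<not> ?thesis"
    have "i \<le> card (upper_central G i)" for i
    proof (induction i)
      case (Suc i)
      have "card (upper_central G i) < card (upper_central G (Suc i))"
        using upper_central_strict * finite_subgroup[OF subgroup_upper_central]
        by (intro psubset_card_mono) auto
      with Suc show ?case by simp
    qed simp
    moreover have "card (upper_central G i) \<le> order G" for i
      unfolding order_def
      by (intro card_mono finite_carrier subgroup.subset subgroup_upper_central)
    ultimately show False by (metis le_trans not_less_eq_eq order_refl)
  qed
  then show ?thesis unfolding nilpotency_class_def by (rule LeastI_ex)
qed

lemma upper_central_less_class: "i < nilpotency_class G \<Longrightarrow> upper_central G i \<noteq> carrier G"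
  unfolding nilpotency_class_def by (rule not_less_Least)

lemma power_card_subgroup_less:
  assumes "subgroup H G" "subgroup K G" "H \<subset> K"
  shows "multiplicity p (card H) < multiplicity p (card K)"
proof -
  have "card H < card K" using assms finite_subgroup by (intro psubset_card_mono) auto
  then have "p ^ multiplicity p (card H) < p ^ multiplicity p (card K)"
    using card_subgroup assms by metis
  then show ?thesis using prime_gt_1_nat[OF prime_p] power_less_imp_less_exp by blast
qed

text \<open>Below the class each step is strict and raises the exponent of \<open>p\<close> by at
  least 1.\<close>

lemma upper_central_exponent_gap:
  assumes "i \<le> j" "j \<le> nilpotency_class G"
  shows "multiplicity p (card (upper_central G i)) + (j - i) \<le> multiplicity p (card (upper_central G j))"
  using assms
proof (induction j rule: dec_induct)
  case (step j)
  have "multiplicity p (card (upper_central G j)) < multiplicity p (card (upper_central G (Suc j)))"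
    using step upper_central_strict upper_central_less_class
    by (intro power_card_subgroup_less subgroup_upper_central) auto
  with step show ?case by simp
qed simp

lemma prime_index_proper:
  assumes "subgroup M G" "order G = p * card M"
  shows "M \<noteq> carrier G"
proof
  assume "M = carrier G"
  then have "card M = p * card M" using assms by (simp add: order_def)
  moreover have "card M > 0"
    unfolding card_gt_0_iff using finite_subgroup[OF assms(1)] subgroup.one_closed[OF assms(1)] by blast
  ultimately show False using prime_gt_1_nat[OF prime_p] by simp
qed

text \<open>Modulo the term \<open>Suc k\<close> the group is noncyclic by
  \<open>upper_central_noncyclic\<close>, so an element outside one subgroup of index
  \<open>p\<close> lies in another.\<close>

lemma two_maximal_subgroups:
  assumes "upper_central G (Suc k) \<noteq> carrier G" "upper_central G (Suc (Suc k)) = carrier G"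
  obtains M1 M2 where "M1 \<lhd> G" "M2 \<lhd> G" "M1 \<noteq> M2"
    "upper_central G (Suc k) \<subseteq> M1" "upper_central G (Suc k) \<subseteq> M2"
    "order G = p * card M1" "order G = p * card M2"
proof -
  let ?D = "upper_central G (Suc k)"
  interpret D: normal ?D G by (rule normal_upper_central)
  have comm: "commutator a u \<in> ?D" if "a \<in> carrier G" "u \<in> carrier G" for a u
    using that assms(2) upper_central_Suc_iff[of a "Suc k"] by blast
  have norm: "M \<lhd> G" if "subgroup M G" "?D \<subseteq> M" for M
    using that comm subgroup.mem_carrier[OF that(1)] by (intro normalI_commutator) auto
  obtain M1 where M1: "subgroup M1 G" "?D \<subseteq> M1" "order G = p * card M1"
    using exists_subgroup_prime_index[OF prime_p order_eq normal_upper_central assms(1)] by blast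
  have "M1 \<noteq> carrier G" using prime_index_proper[OF M1(1,3)] .
  then obtain g where g: "g \<in> carrier G" "g \<notin> M1" using subgroup.subset[OF M1(1)] by blast
  \<comment> \<open>\<open>E\<close> is generated by \<open>g\<close> and \<open>?D\<close>; it is
    proper, and any subgroup of index \<open>p\<close> above it differs from \<open>M1\<close>,
    which misses \<open>g\<close>.\<close>
  define E where "E = {g [^] i \<otimes> b | (i::int) b. b \<in> ?D}"
  have E: "subgroup E G"
  proof
    show "E \<subseteq> carrier G" using g D.mem_carrier by (auto simp: E_def)
    have "\<one> = g [^] (0::int) \<otimes> \<one>" by simp
    then show "\<one> \<in> E" unfolding E_def using D.one_closed by blast
  next
    fix u v assume "u \<in> E" "v \<in> E"
    then obtain i j :: int and a b where ab: "u = g [^] i \<otimes> a" "v = g [^] j \<otimes> b" "a \<in> ?D" "b \<in> ?D"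
      unfolding E_def by blast
    have "u \<otimes> v = g [^] (i + j) \<otimes> ((inv (g [^] j) \<otimes> a \<otimes> g [^] j) \<otimes> b)"
      using ab g D.mem_carrier by (simp add: int_pow_mult m_assoc)
    moreover have "(inv (g [^] j) \<otimes> a \<otimes> g [^] j) \<otimes> b \<in> ?D"
      using ab g by (intro D.m_closed normal_conj_closed[OF normal_upper_central]) auto
    ultimately show "u \<otimes> v \<in> E" unfolding E_def by blast
  next
    fix u assume "u \<in> E"
    then obtain i :: int and a where a: "u = g [^] i \<otimes> a" "a \<in> ?D"
      unfolding E_def by blast
    have "inv u = g [^] (- i) \<otimes> (g [^] i \<otimes> inv a \<otimes> inv (g [^] i))"
      using a g D.mem_carrier by (simp add: int_pow_neg inv_mult_group m_assoc)
    moreover have "g [^] i \<otimes> inv a \<otimes> inv (g [^] i) \<in> ?D"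
      using a g by (intro D.inv_op_closed2) auto
    ultimately show "inv u \<in> E" unfolding E_def by blast
  qed
  have DE: "?D \<subseteq> E"
  proof
    fix b assume "b \<in> ?D"
    then have "b = g [^] (0::int) \<otimes> b" using D.mem_carrier by simp
    then show "b \<in> E" unfolding E_def using \<open>b \<in> ?D\<close> by blast
  qed
  have gE: "g \<in> E"
  proof -
    have "g = g [^] (1::int) \<otimes> \<one>" using g by simp
    then show ?thesis unfolding E_def using D.one_closed by blast
  qed
  have "E \<noteq> carrier G"
  proof
    assume "E = carrier G"
    then have "\<exists>i::int. \<exists>b \<in> ?D. u = g [^] i \<otimes> b" if "u \<in> carrier G" for u
      using that unfolding E_def by blast
    then show False using upper_central_noncyclic g(1) assms(1) by blast
  qed
  then obtain M2 where M2: "subgroup M2 G" "E \<subseteq> M2" "order G = p * card M2"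
    using exists_subgroup_prime_index[OF prime_p order_eq norm[OF E DE]] by blast
  show thesis
  proof (rule that[of M1 M2])
    show "M1 \<lhd> G" "M2 \<lhd> G" using norm M1 M2 DE by auto
    show "M1 \<noteq> M2" using g gE M2 by blast
  qed (use M1 M2 DE in auto)
qed

end

section \<open>Class at most two\<close>


text \<open>All commutators lie in the \<open>k\<close>-th term, hence in \<open>M\<close>.\<close>

lemma (in group) normal_of_commutators_le:
  assumes "subgroup M G" "upper_central G k \<subseteq> M" "upper_central G (Suc k) = carrier G"
  shows "M \<lhd> G"
proof (rule normalI_commutator[OF assms(1)])
  fix a u assume "a \<in> M" and u: "u \<in> carrier G"
  then have "a \<in> upper_central G (Suc k)" using assms subgroup.mem_carrier by simp
  then show "commutator a u \<in> M" using u assms(2) by (auto simp: upper_central_Suc_iff)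
qed

lemma (in group) commutator_hom:
  assumes "x \<in> carrier G" "\<And>u. u \<in> carrier G \<Longrightarrow> commutator x u \<in> upper_central G (Suc 0)"
  shows "commutator x \<in> hom G G"
proof (rule homI)
  fix u v assume uv: "u \<in> carrier G" "v \<in> carrier G"
  have "commutator x u \<otimes> w = w \<otimes> commutator x u" if "w \<in> carrier G" for w
    using assms(2)[OF uv(1)] that by (auto simp: upper_central_one group_center_def)
  then show "commutator x (u \<otimes> v) = commutator x u \<otimes> commutator x v"
    using uv assms(1) by (simp add: commutator_mult_right m_assoc)
qed (use assms in auto)

context finite_p_group
begin

text \<open>If the automorphism of \<open>prime_index_auto\<close> were induced by \<open>w\<close>,
  then \<open>w\<close> would commute with \<open>M\<close> and satisfy
  \<open>commutator g w = x\<close>; the last hypothesis excludes this. The automorphism fixes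
  \<open>frattini G\<close> because \<open>M\<close> is maximal.\<close>

lemma noninner_auto_prime_index:
  assumes "odd p" and M: "M \<lhd> G" "order G = p * card M"
    and g: "g \<in> carrier G" "g \<notin> M"
    and x: "x \<in> M" "x [^] p = \<one>" "x \<noteq> \<one>" "\<And>m. m \<in> M \<Longrightarrow> x \<otimes> m = m \<otimes> x"
    and cent: "commutator x g \<in> group_center G"
    and noninner: "\<And>w. \<lbrakk>w \<in> carrier G; \<And>m. m \<in> M \<Longrightarrow> m \<otimes> w = w \<otimes> m\<rbrakk> \<Longrightarrow> commutator g w \<noteq> x"
  shows "\<exists>\<alpha> \<in> auto G. \<alpha> \<notin> inner_auto G \<and> group.ord (AutoGroup G) \<alpha> = p \<and>
    (\<forall>u \<in> frattini G. \<alpha> u = u)"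
proof -
  have Mc: "m \<in> carrier G" if "m \<in> M" for m
    using that subgroup.mem_carrier[OF normal_imp_subgroup[OF M(1)]] by blast
  obtain \<alpha> where \<alpha>: "\<alpha> \<in> auto G" "group.ord (AutoGroup G) \<alpha> = p"
      "\<And>m. m \<in> M \<Longrightarrow> \<alpha> m = m" "\<alpha> g = g \<otimes> x"
    using prime_index_auto[OF prime_p \<open>odd p\<close> M(1) finite_carrier M(2) g x cent] by blast
  have "\<alpha> \<notin> inner_auto G"
  proof
    assume "\<alpha> \<in> inner_auto G"
    then obtain w where w: "w \<in> carrier G" "\<And>u. u \<in> carrier G \<Longrightarrow> \<alpha> u = u \<otimes> commutator u w"
      by (rule inner_auto_commutator) blast
    have "m \<otimes> w = w \<otimes> m" if m: "m \<in> M" for m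
    proof -
      have "m = m \<otimes> commutator m w" using w(2)[OF Mc[OF m]] \<alpha>(3)[OF m] by simp
      then show ?thesis using Mc[OF m] w(1) by (simp add: commutator_eq_one_iff)
    qed
    moreover have "commutator g w = x"
      using w(2)[OF g(1)] \<alpha>(4) g w(1) Mc[OF x(1)] by simp
    ultimately show False using noninner w(1) by blast
  qed
  moreover have "\<alpha> u = u" if "u \<in> frattini G" for u
  proof -
    have "maximal_subgroup M G"
      using maximal_subgroupI[OF normal_imp_subgroup[OF M(1)] M(2) prime_p finite_carrier] .
    then show ?thesis using that \<alpha>(3) by (auto simp: frattini_def)
  qed
  ultimately show ?thesis using \<alpha> by blast
qed

text \<open>Commutators are trivial, so \<open>x \<noteq> \<one>\<close> already excludes inner
  automorphisms; \<open>n \<ge> 2\<close> makes \<open>M\<close> nontrivial, which provides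
  \<open>x\<close>.\<close>

lemma noninner_auto_abelian:
  assumes "odd p" "upper_central G (Suc 0) = carrier G" "n \<ge> 2"
  shows "\<exists>\<alpha> \<in> auto G. \<alpha> \<notin> inner_auto G \<and> group.ord (AutoGroup G) \<alpha> = p \<and>
    (\<forall>u \<in> frattini G. \<alpha> u = u)"
proof -
  have comm: "u \<otimes> v = v \<otimes> u" if "u \<in> carrier G" "v \<in> carrier G" for u v
    using that assms(2) by (auto simp: upper_central_one group_center_def)
  have "order G \<noteq> 1" using assms(3) order_eq prime_gt_1_nat[OF prime_p] by simp
  then have "{\<one>} \<noteq> carrier G" by (metis order_def One_nat_def card.empty card.insert empty_iff finite.emptyI)
  then obtain M where M: "subgroup M G" "order G = p * card M"
    using exists_subgroup_prime_index[OF prime_p order_eq one_is_normal] by blast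
  have "p * card M = p * p ^ (n - 1)"
    using M(2) order_eq assms(3) by (metis Suc_1 Suc_le_D diff_Suc_1 power_Suc)
  then have "card M = p ^ (n - 1)" using prime_gt_0_nat[OF prime_p] by simp
  moreover have "p ^ 0 < p ^ (n - 1)"
    using assms(3) prime_gt_1_nat[OF prime_p] by (intro power_strict_increasing) auto
  ultimately have cM: "1 < card M" by simp
  then have "M \<noteq> {\<one>}" by auto
  then obtain u where "u \<in> M" "u \<noteq> \<one>" using subgroup.one_closed[OF M(1)] by blast
  then obtain x where x: "x \<in> M" "x \<noteq> \<one>" "x [^] p = \<one>" using exists_order_p[OF M(1)] by blast
  have Mc: "m \<in> carrier G" if "m \<in> M" for m using that subgroup.mem_carrier[OF M(1)] by blast
  have "M \<noteq> carrier G"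
    using M(2) cM prime_gt_1_nat[OF prime_p] by (auto simp: order_def)
  then obtain g where g: "g \<in> carrier G" "g \<notin> M" using Mc by blast
  have one: "commutator a b = \<one>" if "a \<in> carrier G" "b \<in> carrier G" for a b
    using that comm by (simp add: commutator_eq_one_iff)
  show ?thesis
  proof (rule noninner_auto_prime_index[OF assms(1) _ M(2) g x(1,3,2)])
    show "M \<lhd> G"
      using M(1) one Mc subgroup.one_closed[OF M(1)] by (intro normalI_commutator) auto
    show "commutator x g \<in> group_center G"
      using one Mc x g by (simp add: group_center_def)
  qed (use comm Mc x g one in auto)
qed

text \<open>Modulo the \<open>i\<close>-th term, \<open>commutator (a [^] p) u\<close> is the
  \<open>p\<close>-th power of \<open>commutator a u\<close>, so exponent \<open>p\<close> passes
  from one central factor to the next.\<close>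

lemma exponent_p_upper_central_step:
  assumes "a \<in> upper_central G (Suc (Suc i))"
    and "\<And>k. k \<in> upper_central G (Suc i) \<Longrightarrow> k [^] p \<in> upper_central G i"
  shows "a [^] p \<in> upper_central G (Suc i)"
proof -
  have a: "a \<in> carrier G" using assms(1) by (simp add: upper_central_Suc_iff)
  have "commutator (a [^] p) u \<in> upper_central G i" if u: "u \<in> carrier G" for u
  proof -
    have k: "commutator a u \<in> upper_central G (Suc i)"
      using assms(1) u by (simp add: upper_central_Suc_iff)
    have "commutator a u [^] int p \<in> upper_central G i" using assms(2)[OF k] by (simp add: int_pow_int)
    then have "commutator (a [^] int p) u \<in> upper_central G i"
      using commutator_pow_Mod[OF normal_upper_central a u] k a by (simp add: upper_central_Suc_iff)
    then show ?thesis by (simp add: int_pow_int)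
  qed
  then show ?thesis using a by (simp add: upper_central_Suc_iff)
qed

lemma card_prime_exponent:
  assumes "subgroup H G" "card H = p" "u \<in> H"
  shows "u [^] p = \<one>"
    and "\<lbrakk>a \<in> H; a \<noteq> \<one>\<rbrakk> \<Longrightarrow> \<exists>i::nat. u = a [^] i"
proof -
  have "card H = p * card {\<one>}" "{\<one>} \<subseteq> H" using assms subgroup.one_closed[OF assms(1)] by auto
  note * = one_is_normal assms(1) this(2) finite_carrier this(1) prime_p assms(3)
  show "u [^] p = \<one>" using prime_index_pow[OF *] by simp
  show "\<exists>i::nat. u = a [^] i" if "a \<in> H" "a \<noteq> \<one>"
  proof -
    have "a \<in> carrier G" using that subgroup.mem_carrier[OF assms(1)] by blast
    then show ?thesis using prime_index_decomp[OF * that(1)] that(2) by auto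
  qed
qed

lemma card_prime_index_eq:
  assumes "subgroup M G" "order G = p * card M" "n = Suc k"
  shows "card M = p ^ k"
  using assms order_eq prime_gt_0_nat[OF prime_p] by simp

text \<open>Two distinct subgroups of index \<open>p\<close> meet in index at least
  \<open>p ^ 2\<close>. If \<open>D\<close> has exactly this index, it is the intersection, and
  \<open>p\<close>-th powers lie in both subgroups.\<close>

lemma two_maximal_Int:
  assumes "M1 \<lhd> G" "M2 \<lhd> G" "M1 \<noteq> M2" "D \<subseteq> M1" "D \<subseteq> M2" "subgroup D G"
    and "order G = p * card M1" "order G = p * card M2" "n = Suc (Suc k)"
  shows "multiplicity p (card D) \<le> k"
    and "card D = p ^ k \<Longrightarrow> D = M1 \<inter> M2"
    and "\<lbrakk>card D = p ^ k; u \<in> carrier G\<rbrakk> \<Longrightarrow> u [^] p \<in> D"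
proof -
  have sub: "subgroup M1 G" "subgroup M2 G" using assms normal_imp_subgroup by auto
  have c: "card M1 = p ^ Suc k" "card M2 = p ^ Suc k"
    using card_prime_index_eq[OF sub(1) assms(7)] card_prime_index_eq[OF sub(2) assms(8)] assms(9)
    by blast+
  have I: "subgroup (M1 \<inter> M2) G" using sub by (rule subgroups_Inter_pair)
  have "M1 \<inter> M2 \<noteq> M1"
  proof
    assume "M1 \<inter> M2 = M1"
    then have "M1 = M2" using c finite_subgroup[OF sub(2)] by (metis card_subset_eq inf.cobounded2)
    with assms(3) show False ..
  qed
  then have "card (M1 \<inter> M2) < card M1"
    using finite_subgroup[OF sub(1)] by (intro psubset_card_mono) auto
  then have "p ^ multiplicity p (card (M1 \<inter> M2)) < p ^ Suc k"
    using c card_subgroup[OF I] by simp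
  then have *: "multiplicity p (card (M1 \<inter> M2)) \<le> k"
    using prime_gt_1_nat[OF prime_p] power_less_imp_less_exp less_Suc_eq_le by blast
  have le: "card D \<le> card (M1 \<inter> M2)"
    using assms finite_subgroup[OF I] by (intro card_mono) auto
  have "p ^ multiplicity p (card D) \<le> p ^ k"
    using le * card_subgroup[OF I] card_subgroup[OF assms(6)] prime_gt_0_nat[OF prime_p]
    by (metis One_nat_def Suc_leI le_trans power_increasing)
  then show "multiplicity p (card D) \<le> k"
    using prime_gt_1_nat[OF prime_p] power_le_imp_le_exp by blast
  show D: "D = M1 \<inter> M2" if "card D = p ^ k"
  proof (rule card_subset_eq)
    show "card D = card (M1 \<inter> M2)"
      using that le * card_subgroup[OF I] prime_gt_0_nat[OF prime_p]
      by (metis One_nat_def Suc_leI dual_order.antisym power_increasing)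
  qed (use assms finite_subgroup[OF I] in auto)
  assume "card D = p ^ k" and u: "u \<in> carrier G"
  have "u [^] p \<in> M" if "M \<lhd> G" "order G = p * card M" for M
    using prime_index_pow[OF that(1) subgroup_self _ finite_carrier _ prime_p u] that
      subgroup.subset[OF normal_imp_subgroup[OF that(1)]] by (simp add: order_def)
  then show "u [^] p \<in> D" using D \<open>card D = p ^ k\<close> assms by blast
qed

lemma prime_index_decomp_carrier:
  assumes "M \<lhd> G" "order G = p * card M" "g \<in> carrier G" "g \<notin> M" "u \<in> carrier G"
  shows "\<exists>i::nat. \<exists>m \<in> M. u = g [^] i \<otimes> m"
  using prime_index_decomp[OF assms(1) subgroup_self _ finite_carrier _ prime_p assms(5,3,4)]
    assms(2) subgroup.subset[OF normal_imp_subgroup[OF assms(1)]] by (simp add: order_def)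

text \<open>The order is \<open>p ^ 4\<close>. The center has order at most \<open>p ^ 2\<close>,
  \<open>p\<close>-th powers are central, and the \<open>p\<close>-th power map is a homomorphism
  into the center; its kernel \<open>K\<close> decides where \<open>x\<close> is sought.\<close>

lemma noninner_auto_class2:
  assumes "odd p" "upper_central G (Suc 0) \<noteq> carrier G" "upper_central G (Suc (Suc 0)) = carrier G"
    and "n = 4"
  shows "\<exists>\<alpha> \<in> auto G. \<alpha> \<notin> inner_auto G \<and> group.ord (AutoGroup G) \<alpha> = p \<and>
    (\<forall>u \<in> frattini G. \<alpha> u = u)"
proof -
  let ?Z = "upper_central G (Suc 0)"
  define e where "e = multiplicity p (card ?Z)"
  have p1: "p > 1" by (rule prime_gt_1_nat[OF prime_p])
  have Z: "subgroup ?Z G" by (rule subgroup_upper_central)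
  have fZ: "finite ?Z" using finite_subgroup[OF Z] .
  have cZ: "card ?Z = p ^ e" unfolding e_def by (rule card_subgroup[OF Z])
  have comm: "commutator a u \<in> ?Z" if "a \<in> carrier G" "u \<in> carrier G" for a u
    using that assms(3) upper_central_Suc_iff[of a "Suc 0"] by blast
  have Zcomm: "z \<otimes> u = u \<otimes> z" if "z \<in> ?Z" "u \<in> carrier G" for z u
    using that by (auto simp: upper_central_one group_center_def)
  have Zc: "z \<in> carrier G" if "z \<in> ?Z" for z using that subgroup.mem_carrier[OF Z] by blast
  obtain M1 M2 where M: "M1 \<lhd> G" "M2 \<lhd> G" "M1 \<noteq> M2" "?Z \<subseteq> M1" "?Z \<subseteq> M2"
      "order G = p * card M1" "order G = p * card M2"
    using two_maximal_subgroups[OF assms(2,3)] by metis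
  have e2: "e \<le> 2" unfolding e_def
    using two_maximal_Int(1)[OF M(1-5) Z M(6,7)] assms(4) by (simp add: eval_nat_numeral)
  have powZ: "u [^] p \<in> ?Z" if u: "u \<in> carrier G" for u
  proof (cases "e = 2")
    case True
    then show ?thesis
      using two_maximal_Int(3)[OF M(1-5) Z M(6,7) _ _ u] cZ assms(4) by (simp add: eval_nat_numeral)
  next
    case False
    then have "e = 0 \<or> e = 1" using e2 by auto
    then have "z [^] p = \<one>" if "z \<in> ?Z" for z
    proof
      assume "e = 0"
      then have "card ?Z = 1" using cZ by simp
      then show ?thesis using that subgroup.one_closed[OF Z] by (auto simp: card_1_singleton_iff)
    next
      assume "e = 1"
      then show ?thesis using card_prime_exponent(1)[OF Z _ that] cZ by simp
    qed
    \<comment> \<open>Here the second term is all of \<open>G\<close>, so a center of order at most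
      \<open>p\<close> makes all \<open>p\<close>-th powers central.\<close>
    then show ?thesis
      using exponent_p_upper_central_step[of u 0] u assms(3) by (simp only:) simp
  qed
  have commp: "commutator a u [^] p = \<one>" if "a \<in> carrier G" "u \<in> carrier G" for a u
  proof -
    have "commutator (a [^] int p) u = commutator a u [^] int p"
      using that comm[OF that] Zcomm by (intro commutator_int_pow_left) auto
    moreover have "commutator (a [^] p) u = \<one>"
      using powZ Zcomm that by (simp add: commutator_eq_one_iff)
    ultimately show ?thesis by (simp add: int_pow_int)
  qed
  define f where "f u = u [^] p" for u
  have f: "f \<in> hom G G"
    unfolding f_def using comm commp Zcomm assms(1)
    by (intro homI class2_odd_pow) auto
  define K where "K = {u \<in> carrier G. u [^] p = \<one>}"
  have ordK: "p ^ 4 \<le> p ^ e * card K"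
    using hom_card_le[OF f _ fZ] powZ cZ order_eq assms(4) by (auto simp: f_def K_def)
  txt \<open>An element \<open>x \<notin> Z\<^sub>1\<close> is not a commutator. If all elements of order \<open>p\<close> are central, then
    \<open>Z\<^sub>1\<close> has order \<open>p\<^sup>2\<close> and exponent \<open>p\<close>, whereas the commutators with \<open>g\<close> are powers of one element.\<close>
  show ?thesis
  proof (cases "K \<subseteq> ?Z")
    case False
    then obtain x where x: "x \<in> carrier G" "x [^] p = \<one>" "x \<notin> ?Z" by (auto simp: K_def)
    define M where "M = {u \<in> carrier G. \<forall>s \<in> {x}. s \<otimes> u = u \<otimes> s}"
    have sM: "subgroup M G" unfolding M_def using x by (intro centralizer_subgroup) auto
    have "x \<otimes> z = z \<otimes> x" if "z \<in> ?Z" for z using Zcomm[OF that x(1)] by simp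
    then have ZM: "?Z \<subset> M" using x Zc by (auto simp: M_def)
    have Mn: "M \<lhd> G" using normal_of_commutators_le[OF sM _ assms(3)] ZM by blast
    have "M \<noteq> carrier G"
    proof
      assume "M = carrier G"
      then have "x \<in> ?Z" using x by (auto simp: M_def upper_central_one group_center_def)
      with x show False by simp
    qed
    then have Ms: "M \<subset> carrier G" using subgroup.subset[OF sM] by blast
    define m where "m = multiplicity p (card M)"
    have cM: "card M = p ^ m" unfolding m_def by (rule card_subgroup[OF sM])
    have "card (carrier G) = p ^ 4" using order_eq assms(4) by (simp add: order_def)
    then have "multiplicity p (card (carrier G)) = 4"
      using prime_p by (simp add: prime_elem_multiplicity_power_distrib)
    then have m4: "m < 4" "e < m"
      using power_card_subgroup_less[OF sM subgroup_self Ms] power_card_subgroup_less[OF Z sM ZM]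
      by (auto simp: m_def e_def)
    \<comment> \<open>The centralizer \<open>M\<close> is the kernel of \<open>commutator x\<close>
      into the center, so \<open>4 \<le> e + m\<close>; for \<open>e = 2\<close> it is enough that
      \<open>M\<close> exceeds the center.\<close>
    have "m \<ge> 3"
    proof (cases "e = 2")
      case False
      have M_eq: "{u \<in> carrier G. commutator x u = \<one>} = M"
        using x by (auto simp: M_def commutator_eq_one_iff)
      have "order G \<le> card ?Z * card {u \<in> carrier G. commutator x u = \<one>}"
        using commutator_hom[OF x(1) comm[OF x(1)]] comm[OF x(1)] fZ by (intro hom_card_le) auto
      then have "p ^ 4 \<le> p ^ (e + m)"
        using cZ cM order_eq assms(4) M_eq by (simp add: power_add)
      then have "4 \<le> e + m" using p1 power_le_imp_le_exp by blast
      then show ?thesis using False e2 by simp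
    qed (use m4 in simp)
    then have "m = 3" using m4 by simp
    then have ordM: "order G = p * card M" using cM order_eq assms(4) by (simp add: eval_nat_numeral)
    obtain g where g: "g \<in> carrier G" "g \<notin> M" using Ms by blast
    show ?thesis
    proof (rule noninner_auto_prime_index[OF assms(1) Mn ordM g])
      show "x \<in> M" "x [^] p = \<one>" "\<And>m. m \<in> M \<Longrightarrow> x \<otimes> m = m \<otimes> x"
        using x by (auto simp: M_def)
      show "x \<noteq> \<one>" using x subgroup.one_closed[OF Z] by auto
      show "commutator x g \<in> group_center G" using comm x g by (simp add: upper_central_one)
      show "commutator g w \<noteq> x" if "w \<in> carrier G" for w using comm[OF g(1) that] x by auto
    qed
  next
    case True
    then have "card K \<le> card ?Z" using fZ by (intro card_mono)
    then have "p ^ 4 \<le> p ^ (e + e)" using ordK cZ by (metis mult_le_mono2 order_trans power_add)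
    then have "4 \<le> e + e" using p1 power_le_imp_le_exp by blast
    then have e: "e = 2" using e2 by simp
    have "K = ?Z"
    proof (rule card_seteq[OF fZ True])
      have "p ^ 2 * p ^ 2 = p ^ 4" by (simp flip: power_add)
      then have "p ^ 2 * p ^ 2 \<le> p ^ 2 * card K" using ordK e by metis
      then show "card ?Z \<le> card K" using cZ e p1 by (simp only: mult_le_cancel1) auto
    qed
    then have Zp: "z [^] p = \<one>" if "z \<in> ?Z" for z using that by (auto simp: K_def)
    have sM1: "subgroup M1 G" using M normal_imp_subgroup by blast
    have cM1: "card M1 = p ^ 3" using card_prime_index_eq[OF sM1 M(6)] assms(4) by simp
    then have cM1Z: "card M1 = p * card ?Z" using cZ e by (simp add: eval_nat_numeral)
    have M1c: "m \<in> carrier G" if "m \<in> M1" for m using that subgroup.mem_carrier[OF sM1] by blast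
    have "M1 \<noteq> carrier G"
      using M(6) cM1 p1 by (auto simp: order_def)
    then obtain g where g: "g \<in> carrier G" "g \<notin> M1" using M1c by blast
    have "card M1 > card ?Z" using cM1Z p1 cZ by simp
    then obtain h where h: "h \<in> M1" "h \<notin> ?Z" using M(4) by (metis less_irrefl subset_antisym subsetI)
    define c where "c = commutator g h"
    have cc: "c \<in> ?Z" "c \<in> carrier G" using comm g h M1c Zc by (auto simp: c_def)
    have cp: "c [^] p = \<one>" using Zp cc by simp
    \<comment> \<open>\<open>C\<close> holds the powers of \<open>c\<close>, fewer than the
      \<open>p ^ 2\<close> central elements, so \<open>x\<close> can be taken in the center outside
      \<open>C\<close>.\<close>
    define C where "C = (\<lambda>i::nat. c [^] i) ` {..<p}"
    have "card C \<le> p" unfolding C_def using card_image_le[of "{..<p}"] by simp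
    also have "p < card ?Z" using cZ e p1 by (simp add: power2_eq_square)
    finally have "\<not> ?Z \<subseteq> C" using card_mono[of C ?Z] by (auto simp: C_def)
    then obtain x where x: "x \<in> ?Z" "x \<notin> C" by blast
    have inC: "c [^] (i::nat) \<in> C" for i
    proof -
      have "c [^] i = c [^] (i mod p)"
        using int_pow_cong[OF cc(2) cp, of "int i" "int (i mod p)"] int_pow_int
        by (metis dvd_minus_mod zmod_int)
      then show ?thesis using p1 by (auto simp: C_def)
    qed
    have central: "commutator a (u \<otimes> z) = commutator a u"
      if "z \<in> ?Z" "a \<in> carrier G" "u \<in> carrier G" for a u z
    proof -
      have "commutator a z = \<one>" using that Zcomm Zc by (simp add: commutator_eq_one_iff)
      moreover have "inv z \<otimes> commutator a u \<otimes> z = commutator a u"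
        using that Zc Zcomm[OF that(1), of "commutator a u", symmetric] by (simp add: m_assoc)
      ultimately show ?thesis using that Zc by (simp add: commutator_mult_right)
    qed
    show ?thesis
    proof (rule noninner_auto_prime_index[OF assms(1) M(1) M(6) g])
      show "x \<in> M1" "x [^] p = \<one>" using x M Zp by auto
      show "x \<otimes> m = m \<otimes> x" if "m \<in> M1" for m using x Zcomm M1c that by blast
      show "x \<noteq> \<one>" using x inC[of 0] by auto
      have "commutator x g = \<one>" using x g Zcomm Zc by (simp add: commutator_eq_one_iff)
      then show "commutator x g \<in> group_center G" by (simp add: group_center_def)
    next
      \<comment> \<open>Writing \<open>w\<close> as
        \<open>g [^] i \<otimes> h [^] j \<otimes> z\<close> gives
        \<open>commutator g w = c [^] j\<close>.\<close>
      fix w assume w: "w \<in> carrier G"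
      obtain i :: nat and m where m: "m \<in> M1" "w = g [^] i \<otimes> m"
        using prime_index_decomp_carrier[OF M(1,6) g w] by blast
      obtain j :: nat and z where z: "z \<in> ?Z" "m = h [^] j \<otimes> z"
        using prime_index_decomp[OF normal_upper_central sM1 M(4) finite_carrier cM1Z prime_p m(1) h]
        by blast
      have hc: "h \<in> carrier G" using h M1c by blast
      have gg: "commutator g (g [^] i) = \<one>"
        using g int_pow_commutes[of g g "int i"] by (simp add: commutator_eq_one_iff int_pow_int)
      have "w = (g [^] i \<otimes> h [^] j) \<otimes> z" using m z g hc Zc by (simp add: m_assoc)
      then have "commutator g w = commutator g (g [^] i \<otimes> h [^] j)"
        using central z g hc by simp
      also have "\<dots> = commutator g (h [^] j)"
        using gg g hc by (simp add: commutator_mult_right)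
      also have "\<dots> = c [^] j"
        using commutator_int_pow_right[of g h "int j"] g hc cc Zcomm
        by (simp add: c_def int_pow_int)
      finally show "commutator g w \<noteq> x" using inC x by metis
    qed
  qed
qed

end

section \<open>Class at least three\<close>


context finite_p_group
begin

text \<open>If \<open>d\<close> generates the central factor \<open>Z\<^sub>k\<^sub>+\<^sub>2 / Z\<^sub>k\<^sub>+\<^sub>1\<close>, then every \<open>u\<close> with
  \<open>[d, u] \<notin> Z\<^sub>k\<close> has \<open>u\<^sup>p \<in> Z\<^sub>k\<^sub>+\<^sub>1\<close>, because \<open>u\<^sup>p\<close> commutes with \<open>u\<close>.
  The other elements are quotients of two such \<open>u\<close>, and the quotient by \<open>Z\<^sub>k\<^sub>+\<^sub>1\<close> has class 2.\<close>

lemma exponent_p_Mod_upper_central: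
  fixes k
  defines "L \<equiv> upper_central G k" and "N \<equiv> upper_central G (Suc k)"
    and "D \<equiv> upper_central G (Suc (Suc k))"
  assumes "odd p"
    and pN: "\<And>a. a \<in> N \<Longrightarrow> a [^] p \<in> L"
    and cD: "card D = p * card N"
    and pD: "\<And>u. u \<in> carrier G \<Longrightarrow> u [^] p \<in> D"
    and comm: "upper_central G (Suc (Suc (Suc k))) = carrier G"
    and u: "u \<in> carrier G"
  shows "u [^] p \<in> N"
proof -
  have nL: "L \<lhd> G" and nN: "N \<lhd> G" and nD: "D \<lhd> G"
    unfolding L_def N_def D_def by (rule normal_upper_central)+
  interpret L: normal L G by fact
  interpret N: normal N G by fact
  interpret D: normal D G by fact
  have ND: "N \<subseteq> D" unfolding N_def D_def by (rule upper_central_mono_Suc)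
  have D_dest: "commutator x v \<in> N" if "x \<in> D" "v \<in> carrier G" for x v
    using that unfolding D_def N_def by (simp add: upper_central_Suc_iff[of x])
  have N_dest: "commutator x v \<in> L" if "x \<in> N" "v \<in> carrier G" for x v
    using that unfolding L_def N_def by (simp add: upper_central_Suc_iff[of x])
  have GD: "commutator x v \<in> D" if "x \<in> carrier G" "v \<in> carrier G" for x v
    using that comm upper_central_Suc_iff[of x "Suc (Suc k)"] unfolding D_def by blast
  have DpN: "x [^] p \<in> N" if "x \<in> D" for x
    using prime_index_pow[OF nN D.is_subgroup ND finite_carrier cD prime_p that] .
  have "card N > 0" unfolding card_gt_0_iff using finite_subgroup[OF N.is_subgroup] N.one_closed by blast
  then have "card D \<noteq> card N" using cD prime_gt_1_nat[OF prime_p] by simp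
  then have "N \<noteq> D" by metis
  then obtain d where d: "d \<in> D" "d \<notin> N" using ND by auto
  then have dc: "d \<in> carrier G" using D.mem_carrier by blast
  have good: "v [^] p \<in> N" if v: "v \<in> carrier G" "commutator d v \<notin> L" for v
  proof -
    define q where "q = commutator d v"
    have q: "q \<in> N" "q \<in> carrier G" using D_dest[OF d(1) v(1)] v dc by (simp_all add: q_def)
    obtain i :: nat and b where b: "b \<in> N" "v [^] p = d [^] i \<otimes> b"
      using prime_index_decomp[OF nN D.is_subgroup ND finite_carrier cD prime_p pD[OF v(1)] d] by blast
    have bc: "b \<in> carrier G" using b N.mem_carrier by blast
    \<comment> \<open>Expanding this with \<open>v [^] p = d [^] i \<otimes> b\<close> puts
      \<open>commutator (d [^] i) v\<close> into \<open>L\<close>.\<close>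
    have "commutator (v [^] p) v = \<one>"
      using v int_pow_commutes[of v v "int p"] by (simp add: commutator_eq_one_iff int_pow_int)
    then have "inv b \<otimes> commutator (d [^] i) v \<otimes> b = inv (commutator b v)"
      unfolding b(2) using dc v bc inv_equality[of "inv b \<otimes> commutator (d [^] i) v \<otimes> b" "commutator b v"]
      by (simp add: commutator_mult_left)
    also have "\<dots> \<in> L" using N_dest[OF b(1) v(1)] by (rule L.m_inv_closed)
    finally have "commutator (d [^] int i) v \<in> L"
      using normal_conj_iff[OF nL _ bc] dc v by (simp add: int_pow_int)
    moreover have "commutator q d \<in> L" using N_dest[OF q(1) dc] .
    ultimately have "q [^] int i \<in> L"
      using commutator_pow_Mod[OF nL dc v(1)] by (simp add: q_def)
    \<comment> \<open>\<open>q\<close> lies outside \<open>L\<close> but \<open>q [^] p\<close>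
      inside, so \<open>q [^] i \<in> L\<close> forces \<open>p\<close> to divide \<open>i\<close>,
      and then \<open>d [^] i\<close> lies in \<open>N\<close>.\<close>
    then have "int p dvd int i"
      using int_pow_mem_prime[OF L.is_subgroup q(2) _ pN[OF q(1)] prime_p] v(2)
      unfolding q_def by blast
    then obtain t where t: "i = p * t" by auto
    have "(d [^] p) [^] int t \<in> N" by (rule subgroup_int_pow_closed[OF N.is_subgroup DpN[OF d(1)]])
    then have "d [^] i \<in> N" using t dc by (simp add: int_pow_int nat_pow_pow)
    then show ?thesis unfolding b(2) using b(1) by (rule N.m_closed)
  qed
  obtain h where h: "h \<in> carrier G" "commutator d h \<notin> L"
    using d(2) dc unfolding N_def L_def upper_central_Suc_iff[of d] by metis
  show ?thesis
  proof (cases "commutator d u \<in> L")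
    case True
    \<comment> \<open>With \<open>commutator d u\<close> in \<open>L\<close>, both \<open>h\<close>
      and \<open>h \<otimes> u\<close> are covered by \<open>good\<close>, and \<open>u\<close> is
      handled as their quotient.\<close>
    have hu: "commutator d (h \<otimes> u) \<notin> L"
    proof
      assume *: "commutator d (h \<otimes> u) \<in> L"
      have "inv u \<otimes> commutator d h \<otimes> u = inv (commutator d u) \<otimes> commutator d (h \<otimes> u)"
        using dc h u by (simp add: commutator_mult_right)
      also have "\<dots> \<in> L" using * True by (intro L.m_closed L.m_inv_closed)
      finally show False using normal_conj_iff[OF nL _ u] h dc by simp
    qed
    have c: "commutator u h \<in> D" using GD u h by blast
    show ?thesis
    proof (rule class2_odd_pow_Mod[OF nN u h(1)])
      show "commutator (commutator u h) u \<in> N" "commutator (commutator u h) h \<in> N"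
        using D_dest[OF c] u h by auto
      show "commutator u h [^] p \<in> N" using DpN c by blast
      show "h [^] p \<in> N" using good h by blast
      show "(h \<otimes> u) [^] p \<in> N" using good[OF _ hu] h u by blast
    qed fact
  qed (use good u in blast)
qed

text \<open>Let \<open>?e i\<close> be the exponent of \<open>p\<close> in the order of term
  \<open>i\<close>. Then \<open>?e 1 \<ge> 1\<close>, the excluded value gives
  \<open>?e 2 \<ge> 3\<close>, and every later step adds at least 1; the bound \<open>k + 3\<close>
  at term \<open>k + 2\<close> leaves no slack.\<close>

lemma upper_central_orders:
  assumes "nilpotency_class G = k + 3" "n = k + 5"
    and "multiplicity p (card (upper_central G (Suc (Suc 0)))) \<noteq> multiplicity p (card (upper_central G (Suc 0))) + 1"
    and "multiplicity p (card (upper_central G (Suc (Suc k)))) \<le> k + 3"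
  shows "card (upper_central G (Suc 0)) = p"
    and "i \<le> k \<Longrightarrow> card (upper_central G (Suc (Suc i))) = p ^ (i + 3)"
proof -
  let ?e = "\<lambda>i. multiplicity p (card (upper_central G i))"
  have 1: "1 \<le> ?e 1" using upper_central_exponent_gap[of 0 1] assms(1) by simp
  have 2: "?e 1 + 1 \<le> ?e 2" using upper_central_exponent_gap[of 1 2] assms(1) by simp
  have 3: "?e 2 + i \<le> ?e (Suc (Suc i))" "?e (Suc (Suc i)) + (k - i) \<le> ?e (Suc (Suc k))" if "i \<le> k" for i
    using upper_central_exponent_gap[of 2 "Suc (Suc i)"]
      upper_central_exponent_gap[of "Suc (Suc i)" "Suc (Suc k)"] assms(1) that by simp_all
  have n2: "?e 2 \<noteq> ?e 1 + 1" using assms(3) by (simp add: numeral_2_eq_2)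
  have "?e 2 + k \<le> k + 3" using 3(1)[of k] assms(4) by simp
  then have e: "?e 1 = 1" "?e 2 = 3" using 1 2 n2 by linarith+
  show "card (upper_central G (Suc 0)) = p"
    using card_subgroup[OF subgroup_upper_central, of 1] e(1) by simp
  show "card (upper_central G (Suc (Suc i))) = p ^ (i + 3)" if "i \<le> k"
  proof -
    have "?e (Suc (Suc i)) = i + 3" using 3[OF that] e(2) assms(4) that by linarith
    then show ?thesis using card_subgroup[OF subgroup_upper_central, of "Suc (Suc i)"] by metis
  qed
qed

text \<open>Here \<open>Suc k\<close> is \<open>n - 4\<close>, and \<open>?D\<close> below is the
  last proper term. The negated claim is used repeatedly to turn constructed automorphisms into
  inner ones.\<close>

lemma noninner_auto_large_class:
  assumes "odd p" "nilpotency_class G = k + 3" "n = k + 5"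
  shows "\<exists>\<alpha> \<in> auto G. \<alpha> \<notin> inner_auto G \<and> group.ord (AutoGroup G) \<alpha> = p \<and>
    ((\<forall>u \<in> frattini G. \<alpha> u = u) \<or> (\<forall>u \<in> upper_central G (Suc k). \<alpha> u = u))"
proof (rule ccontr)
  assume contr: "\<not> ?thesis"
  let ?Z1 = "upper_central G (Suc 0)" and ?Z2 = "upper_central G (Suc (Suc 0))"
    and ?D = "upper_central G (Suc (Suc k))"
  have p1: "p > 1" by (rule prime_gt_1_nat[OF prime_p])
  have top: "upper_central G (Suc (Suc (Suc k))) = carrier G"
    using upper_central_nilpotency_class assms(2) by (simp add: eval_nat_numeral)
  have Dtop: "?D \<noteq> carrier G" using upper_central_less_class assms(2) by simp
  have Z1top: "?Z1 \<noteq> carrier G" using upper_central_less_class assms(2) by simp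
  note sub = subgroup_upper_central and nrm = normal_upper_central
  have memc: "u \<in> carrier G" if "u \<in> upper_central G i" for u i
    using that subgroup.mem_carrier[OF sub] by blast
  have Zcomm: "z \<otimes> u = u \<otimes> z" if "z \<in> ?Z1" "u \<in> carrier G" for z u
    using that by (auto simp: upper_central_one group_center_def)
  have Z2comm: "commutator u v \<in> ?Z1" "commutator v u \<in> ?Z1" if "u \<in> ?Z2" "v \<in> carrier G" for u v
  proof -
    show *: "commutator u v \<in> ?Z1" using that by (simp add: upper_central_Suc_iff[of u "Suc 0"])
    show "commutator v u \<in> ?Z1"
      using subgroup.m_inv_closed[OF sub *] that memc by (simp add: inv_commutator)
  qed
  have mono12: "?Z1 \<subseteq> ?Z2" "?Z2 \<subseteq> ?D" "?Z1 \<subseteq> ?D"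
    by (rule upper_central_mono; simp)+
  \<comment> \<open>The contrapositive of \<open>noninner_auto_prime_index\<close>: under the
    negated claim, an element \<open>w\<close> of the kind excluded there exists.\<close>
  have key: "\<exists>w \<in> carrier G. (\<forall>m \<in> M. m \<otimes> w = w \<otimes> m) \<and> commutator g w = x"
    if "M \<lhd> G" "order G = p * card M" "g \<in> carrier G" "g \<notin> M" "x \<in> M" "x [^] p = \<one>" "x \<noteq> \<one>"
      "\<And>m. m \<in> M \<Longrightarrow> x \<otimes> m = m \<otimes> x" "commutator x g \<in> ?Z1" for M g x
    using noninner_auto_prime_index[OF assms(1) that(1-8) that(9)[unfolded upper_central_one]] contr
    by blast
  obtain M1 M2 where M: "M1 \<lhd> G" "M2 \<lhd> G" "M1 \<noteq> M2" "?D \<subseteq> M1" "?D \<subseteq> M2"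
      "order G = p * card M1" "order G = p * card M2"
    using two_maximal_subgroups[OF Dtop top] by metis
  have n': "n = Suc (Suc (k + 3))" using assms(3) by simp
  note Int = two_maximal_Int[OF M(1-5) sub M(6,7) n']
  have "\<one> \<in> ?Z1" "?Z1 \<noteq> {\<one>}"
  proof -
    show "\<one> \<in> ?Z1" using subgroup.one_closed[OF sub] .
    have "upper_central G 0 \<noteq> carrier G"
      using upper_central_less_class[of 0] assms(2) by simp
    then show "?Z1 \<noteq> {\<one>}" using upper_central_strict[of 0] by auto
  qed
  then obtain z0 where z0: "z0 \<in> ?Z1" "z0 \<noteq> \<one>" "z0 [^] p = \<one>"
    using exists_order_p[OF sub[of "Suc 0"]] by blast
  \<comment> \<open>With the central \<open>z0\<close> as \<open>x\<close>, \<open>key\<close>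
    yields for each such \<open>M\<close> an element of \<open>?Z2\<close> whose centralizer is
    exactly \<open>M\<close>.\<close>
  have dual: "\<exists>y \<in> ?Z2. y \<notin> ?Z1 \<and> (\<forall>m \<in> M. m \<otimes> y = y \<otimes> m) \<and>
      (\<forall>u \<in> carrier G. u \<otimes> y = y \<otimes> u \<longrightarrow> u \<in> M)"
    if M: "M \<lhd> G" "?D \<subseteq> M" "order G = p * card M" for M
  proof -
    have sM: "subgroup M G" using M(1) normal_imp_subgroup by blast
    have Mc: "M \<subseteq> carrier G" using subgroup.subset[OF sM] .
    obtain g where g: "g \<in> carrier G" "g \<notin> M" using prime_index_proper[OF sM M(3)] Mc by blast
    have "commutator z0 g = \<one>" using z0 g Zcomm memc by (simp add: commutator_eq_one_iff)
    then have "commutator z0 g \<in> ?Z1" using \<open>\<one> \<in> ?Z1\<close> by simp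
    moreover have "z0 \<in> M" using z0(1) M(2) mono12(3) by blast
    moreover have "z0 \<otimes> m = m \<otimes> z0" if "m \<in> M" for m using Zcomm[OF z0(1)] Mc that by blast
    ultimately obtain y where y: "y \<in> carrier G" "\<And>m. m \<in> M \<Longrightarrow> m \<otimes> y = y \<otimes> m" "commutator g y = z0"
      using key[OF M(1,3) g _ z0(3,2)] by blast
    note dec = prime_index_decomp_carrier[OF M(1,3)]
    have "y \<in> ?Z2"
      using upper_centralI_prime_index[OF y(1) g(1) _ Mc y(2) dec[OF g]] y(3) z0(1) by blast
    moreover have "y \<notin> ?Z1"
    proof
      assume "y \<in> ?Z1"
      then have "g \<otimes> y = y \<otimes> g" using Zcomm[OF _ g(1)] by simp
      then have "commutator g y = \<one>" using y(1) g(1) by (simp add: commutator_eq_one_iff)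
      with y z0 show False by simp
    qed
    moreover have "u \<in> M" if u: "u \<in> carrier G" "u \<otimes> y = y \<otimes> u" for u
    proof (rule ccontr)
      assume "u \<notin> M"
      then obtain i :: nat and m where m: "m \<in> M" "g = u [^] i \<otimes> m"
        using dec[OF u(1) _ g(1)] by blast
      define C where "C = {v \<in> carrier G. \<forall>s \<in> {y}. s \<otimes> v = v \<otimes> s}"
      have C: "subgroup C G" unfolding C_def using y by (intro centralizer_subgroup) auto
      have "u \<in> C" "m \<in> C" using u y m Mc by (auto simp: C_def)
      then have "g \<in> C" unfolding m(2)
        using subgroup.m_closed[OF C] subgroup_int_pow_closed[OF C, of u "int i"] by (simp add: int_pow_int)
      then have "commutator g y = \<one>" using g(1) y(1) by (simp add: C_def commutator_eq_one_iff)
      with y z0 show False by simp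
    qed
    ultimately show ?thesis using y by blast
  qed
  obtain y1 where y1: "y1 \<in> ?Z2" "y1 \<notin> ?Z1" "\<And>m. m \<in> M1 \<Longrightarrow> m \<otimes> y1 = y1 \<otimes> m"
      "\<And>u. \<lbrakk>u \<in> carrier G; u \<otimes> y1 = y1 \<otimes> u\<rbrakk> \<Longrightarrow> u \<in> M1"
    using dual[OF M(1,4,6)] by blast
  obtain y2 where y2: "y2 \<in> ?Z2" "y2 \<notin> ?Z1" "\<And>m. m \<in> M2 \<Longrightarrow> m \<otimes> y2 = y2 \<otimes> m"
      "\<And>u. \<lbrakk>u \<in> carrier G; u \<otimes> y2 = y2 \<otimes> u\<rbrakk> \<Longrightarrow> u \<in> M2"
    using dual[OF M(2,5,7)] by blast
  have sM1: "subgroup M1 G" and sM2: "subgroup M2 G" using M normal_imp_subgroup by auto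
  have yc: "y1 \<in> carrier G" "y2 \<in> carrier G" using y1 y2 memc by auto
  \<comment> \<open>If \<open>y2\<close> were a power of \<open>y1\<close> times a central element,
    it would commute with \<open>M1\<close>, forcing \<open>M1 = M2\<close>.\<close>
  have indep: False if "y2 = y1 [^] (i::nat) \<otimes> b" "b \<in> ?Z1" for i b
  proof -
    have "M1 \<subseteq> M2"
    proof
      fix m assume m: "m \<in> M1"
      then have mc: "m \<in> carrier G" using subgroup.mem_carrier[OF sM1] by blast
      define C where "C = {v \<in> carrier G. \<forall>s \<in> {m}. s \<otimes> v = v \<otimes> s}"
      have C: "subgroup C G" unfolding C_def using mc by (intro centralizer_subgroup) auto
      have "m \<otimes> b = b \<otimes> m" using Zcomm[OF that(2) mc] by simp
      then have "y1 \<in> C" "b \<in> C" using yc y1(3)[OF m] that(2) memc by (auto simp: C_def)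
      then have "y2 \<in> C" unfolding that(1)
        using subgroup.m_closed[OF C] subgroup_int_pow_closed[OF C, of y1 "int i"] by (simp add: int_pow_int)
      then show "m \<in> M2" using y2(4) mc by (simp add: C_def)
    qed
    moreover have "card M1 = card M2" using M(6,7) prime_gt_0_nat[OF prime_p] by simp
    ultimately have "M1 = M2" using finite_subgroup[OF sM2] by (metis card_subset_eq)
    with M(3) show False ..
  qed
  have noindex: "card Y \<noteq> p * card ?Z1" if "subgroup Y G" "?Z1 \<subseteq> Y" "y1 \<in> Y" "y2 \<in> Y" for Y
    using prime_index_decomp[OF nrm that(1,2) finite_carrier _ prime_p that(4,3) y1(2)] indep by blast
  have "multiplicity p (card ?Z2) \<noteq> multiplicity p (card ?Z1) + 1"
    using noindex[OF sub mono12(1) y1(1) y2(1)] card_subgroup[OF sub, of "Suc 0"]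
      card_subgroup[OF sub, of "Suc (Suc 0)"] by (metis Suc_eq_plus1 power_Suc)
  note orders = upper_central_orders[OF assms(2,3) this Int(1)]
  have cZ1: "card ?Z1 = p" by (rule orders(1))
  have cZ2: "card ?Z2 = p ^ 3" using orders(2)[of 0] by simp
  have cD: "card ?D = p ^ (k + 3)" using orders(2)[of k] by simp
  have D_eq: "?D = M1 \<inter> M2" by (rule Int(2)[OF cD])
  have Dpow: "u [^] p \<in> ?D" if "u \<in> carrier G" for u by (rule Int(3)[OF cD that])
  have Z1p: "z [^] p = \<one>" if "z \<in> ?Z1" for z by (rule card_prime_exponent(1)[OF sub cZ1 that])
  have Z2p: "y [^] p \<in> ?Z1" if "y \<in> ?Z2" for y
    using exponent_p_upper_central_step[OF that] Z1p by simp
  \<comment> \<open>The aim is \<open>Y = ?Z2\<close>: containing the center, \<open>y1\<close> and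
    \<open>y2\<close>, \<open>Y\<close> has order neither \<open>p\<close> nor
    \<open>p ^ 2\<close>.\<close>
  define Y where "Y = ?Z2 \<inter> {v \<in> carrier G. \<forall>s \<in> ?D. s \<otimes> v = v \<otimes> s}"
  have Y: "subgroup Y G"
    unfolding Y_def using sub memc by (intro subgroups_Inter_pair centralizer_subgroup) auto
  have YZ1: "?Z1 \<subseteq> Y"
  proof
    fix z assume z: "z \<in> ?Z1"
    have "s \<otimes> z = z \<otimes> s" if "s \<in> ?D" for s using Zcomm[OF z memc[OF that]] by simp
    then show "z \<in> Y" unfolding Y_def using z mono12 memc by auto
  qed
  have yY: "y1 \<in> Y" "y2 \<in> Y" using y1 y2 yc M(4,5) by (auto simp: Y_def)
  have "Y = ?Z2"
  proof (rule card_subset_eq)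
    show "finite ?Z2" using finite_subgroup[OF sub] .
    show "Y \<subseteq> ?Z2" by (auto simp: Y_def)
    define f where "f = multiplicity p (card Y)"
    have cY: "card Y = p ^ f" unfolding f_def by (rule card_subgroup[OF Y])
    have "?Z1 \<subset> Y" using YZ1 yY y1(2) by blast
    then have "card ?Z1 < card Y" using finite_subgroup[OF Y] by (intro psubset_card_mono)
    then have "p ^ 1 < p ^ f" using cY cZ1 by simp
    then have "1 < f" using p1 power_less_imp_less_exp by blast
    moreover have "f \<noteq> 2" using noindex[OF Y YZ1 yY] cY cZ1 by (auto simp: power2_eq_square)
    ultimately have "3 \<le> f" by simp
    then have "card ?Z2 \<le> card Y" using cZ2 cY p1 by (simp add: power_increasing)
    moreover have "card Y \<le> card ?Z2" using \<open>finite ?Z2\<close> by (intro card_mono) (auto simp: Y_def)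
    ultimately show "card Y = card ?Z2" by simp
  qed
  then have DZ2: "d \<otimes> y = y \<otimes> d" if "d \<in> ?D" "y \<in> ?Z2" for d y
    using that by (auto simp: Y_def)
  \<comment> \<open>Commuting with \<open>y1\<close> and \<open>y2\<close> alone already puts
    \<open>u\<close> into \<open>M1 \<inter> M2\<close>.\<close>
  have CZ2: "u \<in> ?D" if "u \<in> carrier G" "\<And>y. y \<in> ?Z2 \<Longrightarrow> u \<otimes> y = y \<otimes> u" for u
    using that y1(1,4) y2(1,4) D_eq by blast
  \<comment> \<open>The \<open>p\<close>-th powers of \<open>y1\<close> and \<open>y2\<close> lie in
    a center of order \<open>p\<close>, so dividing \<open>y2\<close> by a power of
    \<open>y1\<close> can make the \<open>p\<close>-th power trivial; \<open>?Z2\<close> is abelian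
    as part of \<open>?D\<close>.\<close>
  have "\<exists>x \<in> ?Z2. x \<notin> ?Z1 \<and> x [^] p = \<one>"
  proof (cases "y1 [^] p = \<one>")
    case False
    have "y1 [^] p \<in> ?Z1" "y2 [^] p \<in> ?Z1" using Z2p y1 y2 by auto
    then obtain i :: nat where i: "y2 [^] p = (y1 [^] p) [^] i"
      using card_prime_exponent(2)[OF sub cZ1 _ _ False] by blast
    define v where "v = y1 [^] i"
    have v: "v \<in> ?Z2" "v \<in> carrier G"
      using subgroup_int_pow_closed[OF sub y1(1), of "int i"] yc by (auto simp: v_def int_pow_int)
    define x where "x = inv v \<otimes> y2"
    have xZ2: "x \<in> ?Z2" using v y2(1) subgroup.m_closed[OF sub] subgroup.m_inv_closed[OF sub]
      by (simp add: x_def)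
    have xc: "x \<in> carrier G" using xZ2 memc by blast
    have y2_eq: "y2 = v \<otimes> x" using v yc by (simp add: x_def)
    have vx: "v \<otimes> x = x \<otimes> v" using DZ2 mono12(2) v(1) xZ2 by blast
    have "y2 [^] p = v [^] p \<otimes> x [^] p"
      unfolding y2_eq using vx v xc by (intro pow_mult_distrib)
    moreover have "v [^] p = (y1 [^] p) [^] i"
      using yc by (simp add: v_def nat_pow_pow mult.commute)
    ultimately have "x [^] p = \<one>"
      using i v xc by (metis l_cancel_one' nat_pow_closed)
    moreover have "x \<notin> ?Z1" using indep y2_eq by (auto simp: v_def)
    ultimately show ?thesis using xZ2 by blast
  qed (use y1 in blast)
  then obtain x where x: "x \<in> ?Z2" "x \<notin> ?Z1" "x [^] p = \<one>" by blast
  have xc: "x \<in> carrier G" using x memc by blast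
  have x1: "x \<noteq> \<one>" using x subgroup.one_closed[OF sub] by auto
  define M where "M = {u \<in> carrier G. \<forall>s \<in> {x}. s \<otimes> u = u \<otimes> s}"
  have sM: "subgroup M G" unfolding M_def using xc by (intro centralizer_subgroup) auto
  have Mc: "M \<subseteq> carrier G" using subgroup.subset[OF sM] .
  have DM: "?D \<subseteq> M"
    using DZ2[OF _ x(1), symmetric] memc[of _ "Suc (Suc k)"] by (auto simp: M_def)
  have nM: "M \<lhd> G" by (rule normal_of_commutators_le[OF sM DM top])
  have Mx: "x \<otimes> m = m \<otimes> x" if "m \<in> M" for m using that by (simp add: M_def)
  have "M \<noteq> carrier G"
  proof
    assume "M = carrier G"
    then have "x \<in> ?Z1" using xc by (auto simp: M_def upper_central_one group_center_def)
    with x show False by simp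
  qed
  then obtain g where g: "g \<in> carrier G" "g \<notin> M" using Mc by blast
  \<comment> \<open>The map \<open>commutator x\<close> goes into the center of order
    \<open>p\<close>, so its kernel \<open>M\<close> has index at most \<open>p\<close>, and
    \<open>M\<close> is proper.\<close>
  have cM: "card M = p ^ (k + 4)"
  proof -
    define f where "f = multiplicity p (card M)"
    have f: "card M = p ^ f" unfolding f_def by (rule card_subgroup[OF sM])
    have "card M < card (carrier G)" using g Mc finite_carrier by (intro psubset_card_mono) auto
    then have "p ^ f < p ^ (k + 5)" using f order_eq assms(3) by (simp add: order_def)
    then have "f < k + 5" using p1 power_less_imp_less_exp by blast
    have M_eq: "{u \<in> carrier G. commutator x u = \<one>} = M"
      using xc by (auto simp: M_def commutator_eq_one_iff)
    have "order G \<le> card ?Z1 * card {u \<in> carrier G. commutator x u = \<one>}"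
      using commutator_hom[OF xc Z2comm(1)[OF x(1)]] Z2comm(1)[OF x(1)] finite_subgroup[OF sub]
      by (intro hom_card_le) auto
    then have "p ^ (k + 5) \<le> p ^ Suc f" using cZ1 f order_eq assms(3) M_eq by simp
    then have "k + 5 \<le> Suc f" using p1 power_le_imp_le_exp by blast
    then have "f = k + 4" using \<open>f < k + 5\<close> by simp
    then show ?thesis using f by simp
  qed
  have ordM: "order G = p * card M" using cM order_eq assms(3) by (simp add: eval_nat_numeral)
  have cMD: "card M = p * card ?D" using cM cD by (simp add: eval_nat_numeral)
  note decG = prime_index_decomp_carrier[OF nM ordM g]
  have z: "commutator x g \<in> ?Z1" using Z2comm x g by blast
  \<comment> \<open>Now \<open>key\<close> is applied to a noncentral \<open>x\<close>; the element
    \<open>y\<close> lies in the third term but, as \<open>commutator g y = x\<close> is not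
    central, not in \<open>?Z2\<close>.\<close>
  obtain y where y: "y \<in> carrier G" "\<And>m. m \<in> M \<Longrightarrow> m \<otimes> y = y \<otimes> m" "commutator g y = x"
    using key[OF nM ordM g _ x(3) x1 Mx z] x(1) mono12 DM by blast
  have yZ3: "y \<in> upper_central G (Suc (Suc (Suc 0)))"
    using upper_centralI_prime_index[OF y(1) g(1) _ Mc y(2) decG] y(3) x(1) by blast
  \<comment> \<open>\<open>M\<close> contains \<open>?Z2\<close>, so \<open>y\<close> commutes with
    \<open>?Z2\<close> and \<open>CZ2\<close> applies.\<close>
  have yD: "y \<in> ?D"
  proof (rule CZ2[OF y(1)])
    show "y \<otimes> s = s \<otimes> y" if "s \<in> ?Z2" for s
      using y(2)[of s] that mono12(2) DM by auto
  qed
  have yZ2: "y \<notin> ?Z2" using Z2comm(2)[OF _ g(1)] y(3) x(2) by blast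
  \<comment> \<open>For \<open>k = 0\<close>, \<open>?D\<close> and \<open>?Z2\<close>
    coincide.\<close>
  then have "k \<noteq> 0" using yD by (cases k) auto
  then obtain k' where k': "k = Suc k'" by (cases k) auto
  \<comment> \<open>\<open>?N\<close> is the term \<open>n - 4\<close>, and \<open>?L\<close> the
    one below it.\<close>
  let ?L = "upper_central G (Suc k')" and ?N = "upper_central G (Suc (Suc k'))"
  have cN: "card ?N = p ^ (k' + 3)" using orders(2)[of k'] k' by simp
  then have cDN: "card ?D = p * card ?N" using cD unfolding k' by (simp only: add_Suc power_Suc)
  have mono: "?Z2 \<subseteq> ?N" "?N \<subseteq> ?D" "?L \<subseteq> ?N"
    unfolding k' by (rule upper_central_mono; simp)+
  \<comment> \<open>For \<open>k' = 0\<close> the factor is \<open>?Z2\<close> modulo the center, of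
    order \<open>p ^ 2\<close>; otherwise it has order \<open>p\<close>.\<close>
  have NL: "a [^] p \<in> ?L" if a: "a \<in> ?N" for a
  proof (cases k')
    case 0
    then show ?thesis using Z2p a by simp
  next
    case (Suc j)
    then have "card ?N = p * card ?L" using cN orders(2)[of j] unfolding k' Suc by (simp only: add_Suc power_Suc)
    then show ?thesis
      using prime_index_pow[OF nrm sub mono(3) finite_carrier _ prime_p a] by blast
  qed
  have Npow: "u [^] p \<in> ?N" if "u \<in> carrier G" for u
    using exponent_p_Mod_upper_central[OF assms(1) NL, of u] cDN Dpow top that
    unfolding k' by blast
  have "card M \<noteq> card ?D" using cMD cD p1 by simp
  then have "M \<noteq> ?D" by metis
  then obtain h where h: "h \<in> M" "h \<notin> ?D" using DM by auto
  have hc: "h \<in> carrier G" using h Mc by blast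
  note decM = prime_index_decomp[OF nrm sM DM finite_carrier cMD prime_p _ h]
  define q where "q = commutator h g"
  have qD: "q \<in> ?D" using top hc g(1) upper_central_Suc_iff[of h "Suc (Suc k)"] by (simp add: q_def)
  have qc: "q \<in> carrier G" using qD memc by blast
  interpret N: normal ?N G by (rule nrm)
  \<comment> \<open>Otherwise \<open>g\<close> would commute modulo \<open>?N\<close> with
    \<open>g\<close>, \<open>h\<close> and \<open>?D\<close>, which generate \<open>G\<close>, and
    so lie in \<open>?D\<close>.\<close>
  have qN: "q \<notin> ?N"
  proof
    assume qN: "q \<in> ?N"
    have "commutator g u \<in> ?N" if u: "u \<in> carrier G" for u
    proof -
      obtain i :: nat and m where m: "m \<in> M" "u = g [^] i \<otimes> m" using decG[OF u] by blast
      obtain j :: nat and d where d: "d \<in> ?D" "m = h [^] j \<otimes> d" using decM[OF m(1)] by blast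
      have dc: "d \<in> carrier G" using d memc by blast
      have gg: "commutator g (g [^] i) = \<one>"
        using g int_pow_commutes[of g g "int i"] by (simp add: commutator_eq_one_iff int_pow_int)
      have "commutator d g \<in> ?N" using d(1) g(1) unfolding k' by (simp add: upper_central_Suc_iff[of d])
      then have "inv (commutator d g) \<in> ?N" by (rule N.m_inv_closed)
      then have gd: "commutator g d \<in> ?N" using dc g by (simp add: inv_commutator)
      have gh: "commutator (h [^] t) g \<in> ?N" for t :: nat
      proof (induction t)
        case 0
        then show ?case using g N.one_closed by (simp add: commutator_def)
      next
        case (Suc t)
        then show ?case
          using hc g qN by (simp add: commutator_mult_left q_def N.m_closed normal_conj_closed[OF nrm])
      qed
      from N.m_inv_closed[OF gh[of j]] have "commutator g (h [^] j) \<in> ?N"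
        using hc g by (simp add: inv_commutator)
      then have "commutator g m \<in> ?N"
        unfolding d(2) using gd hc dc g
        by (simp add: commutator_mult_right N.m_closed normal_conj_closed[OF nrm])
      then show ?thesis
        unfolding m(2) using gg g m Mc by (auto simp: commutator_mult_right)
    qed
    then have "g \<in> ?D" using g(1) unfolding k' by (simp add: upper_central_Suc_iff[of g])
    with g DM show False by blast
  qed
  note decD = prime_index_decomp[OF nrm sub mono(2) finite_carrier cDN prime_p _ qD qN]
  have xN: "x \<in> ?N" using x mono by blast
  \<comment> \<open>Modulo \<open>?N\<close> the elements \<open>g\<close>, \<open>h\<close>,
    \<open>q\<close> provide coordinates along the chain \<open>G\<close>, \<open>M\<close>,
    \<open>?D\<close>, \<open>?N\<close>, each of index \<open>p\<close> in the one before.\<close>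
  have "\<exists>\<alpha> \<in> auto G. group.ord (AutoGroup G) \<alpha> = p \<and> (\<forall>m \<in> ?N. \<alpha> m = m) \<and> \<alpha> h = h \<otimes> x
    \<and> (\<forall>u \<in> carrier G. \<exists>i j::int. \<alpha> u = u \<otimes> (x [^] (i::int) \<otimes> commutator x g [^] j))"
  proof (rule heisenberg_auto[OF prime_p nrm g(1) hc q_def _ _ _ _ xN x(3) x1])
    fix u assume "u \<in> carrier G"
    then obtain i :: nat and m where m: "m \<in> M" "u = g [^] i \<otimes> m" using decG by blast
    obtain j :: nat and d where d: "d \<in> ?D" "m = h [^] j \<otimes> d" using decM[OF m(1)] by blast
    obtain l :: nat and b where b: "b \<in> ?N" "d = q [^] l \<otimes> b" using decD[OF d(1)] by blast
    have "u = (g [^] i \<otimes> h [^] j \<otimes> q [^] l) \<otimes> b"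
      using m d b g hc qc N.mem_carrier by (simp add: m_assoc)
    then have "inv (g [^] int i \<otimes> h [^] int j \<otimes> q [^] int l) \<otimes> u \<in> ?N"
      using b g hc qc by (simp add: int_pow_int)
    then show "\<exists>(i::int) (j::int) (l::int). inv (g [^] i \<otimes> h [^] j \<otimes> q [^] l) \<otimes> u \<in> ?N" by blast
  next
    fix i j l :: int
    assume w: "g [^] i \<otimes> h [^] j \<otimes> q [^] l \<in> ?N"
    have red: "a [^] t \<in> ?N" if t: "int p dvd t" and a: "a \<in> carrier G" for a and t :: int
    proof -
      obtain r where "t = int p * r" using t by blast
      then have "a [^] t = (a [^] p) [^] r" using a by (simp add: int_pow_pow int_pow_int[symmetric])
      then show ?thesis using subgroup_int_pow_closed[OF sub Npow[OF a]] by simp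
    qed
    have strip: "b \<in> S" if "subgroup S G" "a \<otimes> b \<in> S" "a \<in> S" "b \<in> carrier G" for S a b
    proof -
      have "inv a \<otimes> (a \<otimes> b) \<in> S" using that subgroup.m_closed subgroup.m_inv_closed by metis
      then show ?thesis using that subgroup.mem_carrier[OF that(1,3)] by simp
    qed
    \<comment> \<open>The exponents are read off one at a time: modulo \<open>M\<close> for
      \<open>i\<close>, then modulo \<open>?D\<close> for \<open>j\<close>, then modulo
      \<open>?N\<close> for \<open>l\<close>.\<close>
    have qM: "q [^] l \<in> ?D" using subgroup_int_pow_closed[OF sub qD] .
    have "h [^] j \<in> M" using subgroup_int_pow_closed[OF sM h(1)] .
    then have hq: "h [^] j \<otimes> q [^] l \<in> M" using qM DM subgroup.m_closed[OF sM] by blast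
    have w': "g [^] i \<otimes> (h [^] j \<otimes> q [^] l) \<in> ?N" using w g hc qc by (simp add: m_assoc)
    have "(g [^] i \<otimes> (h [^] j \<otimes> q [^] l)) \<otimes> inv (h [^] j \<otimes> q [^] l) \<in> M"
      using w' mono(2) DM hq subgroup.m_closed[OF sM] subgroup.m_inv_closed[OF sM] by blast
    then have "g [^] i \<in> M" using g hc qc by (simp add: m_assoc)
    then have i: "int p dvd i"
      using int_pow_mem_prime[OF sM g _ prime_p] Npow[OF g(1)] mono(2) DM by blast
    have hqN: "h [^] j \<otimes> q [^] l \<in> ?N" using strip[OF sub w' red[OF i g(1)]] hc qc by simp
    have "h [^] j \<otimes> q [^] l \<otimes> inv (q [^] l) \<in> ?D"
      by (rule subgroup.m_closed[OF sub subsetD[OF mono(2) hqN] subgroup.m_inv_closed[OF sub qM]])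
    then have "h [^] j \<in> ?D" using hc qc by (simp add: m_assoc)
    then have j: "int p dvd j"
      using int_pow_mem_prime[OF sub hc h(2) _ prime_p] Npow[OF hc] mono(2) by blast
    have "q [^] l \<in> ?N" using strip[OF sub hqN red[OF j hc]] qc by simp
    then have "int p dvd l" using int_pow_mem_prime[OF sub qc qN Npow[OF qc] prime_p] by blast
    with i j show "int p dvd i \<and> int p dvd j \<and> int p dvd l" by blast
  next
    show "commutator q g \<in> ?N" "commutator q h \<in> ?N"
      using qD g(1) hc unfolding k' by (simp_all add: upper_central_Suc_iff[of q])
    show "x \<otimes> h = h \<otimes> x" using Mx h by blast
    show "x \<otimes> q = q \<otimes> x" using Mx qD DM by blast
    show "x \<otimes> m = m \<otimes> x" if "m \<in> ?N" for m using that Mx mono DM by blast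
    show "commutator x g \<in> group_center G" using z by (simp add: upper_central_one)
  qed
  then obtain \<alpha> where \<alpha>: "\<alpha> \<in> auto G" "group.ord (AutoGroup G) \<alpha> = p" "\<And>m. m \<in> ?N \<Longrightarrow> \<alpha> m = m"
      "\<alpha> h = h \<otimes> x"
      "\<And>u. u \<in> carrier G \<Longrightarrow> \<exists>(i::int) (j::int). \<alpha> u = u \<otimes> (x [^] i \<otimes> commutator x g [^] j)"
    by blast
  then have "\<alpha> \<in> inner_auto G" using contr unfolding k' by blast
  then obtain w where w: "w \<in> carrier G" "\<And>u. u \<in> carrier G \<Longrightarrow> \<alpha> u = u \<otimes> commutator u w"
    by (rule inner_auto_commutator) blast
  have hw: "commutator h w = x" using w(2)[OF hc] \<alpha>(4) hc w(1) xc by simp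
  \<comment> \<open>All commutators \<open>commutator u w\<close> are products of powers of
    \<open>x\<close> and \<open>commutator x g\<close>, which lie in \<open>?Z2\<close>.\<close>
  have "w \<in> upper_central G (Suc (Suc (Suc 0)))"
  proof -
    have "commutator w u \<in> ?Z2" if u: "u \<in> carrier G" for u
    proof -
      obtain i j :: int where "\<alpha> u = u \<otimes> (x [^] i \<otimes> commutator x g [^] j)" using \<alpha>(5)[OF u] by blast
      then have "commutator u w = x [^] i \<otimes> commutator x g [^] j"
        using w u xc g by simp
      also have "\<dots> \<in> ?Z2"
        using subgroup_int_pow_closed[OF sub x(1)] subgroup_int_pow_closed[OF sub subsetD[OF mono12(1) z]]
        by (rule subgroup.m_closed[OF sub])
      finally have "inv (commutator u w) \<in> ?Z2" by (rule subgroup.m_inv_closed[OF sub])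
      then show ?thesis using u w by (simp add: inv_commutator)
    qed
    then show ?thesis using w by (simp add: upper_central_Suc_iff[of w "Suc (Suc 0)"])
  qed
  \<comment> \<open>As \<open>k \<noteq> 0\<close>, the third factor has order \<open>p\<close>;
    thus \<open>y\<close> generates it, and \<open>w\<close> is a power of \<open>y\<close> times
    some \<open>s\<close> in \<open>?Z2\<close>.\<close>
  moreover have "card (upper_central G (Suc (Suc (Suc 0)))) = p * card ?Z2"
    using orders(2)[of 1] k' cZ2 by (simp add: eval_nat_numeral)
  ultimately obtain i :: nat and s where s: "s \<in> ?Z2" "w = y [^] i \<otimes> s"
    using prime_index_decomp[OF nrm sub upper_central_mono_Suc finite_carrier _ prime_p _ yZ3 yZ2] by blast
  have sc: "s \<in> carrier G" using s memc by blast
  have "y \<otimes> h = h \<otimes> y" using y(2)[OF h(1)] by simp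
  then have "y [^] i \<otimes> h = h \<otimes> y [^] i"
    using int_pow_commutes[of y h "int i"] y(1) hc by (simp add: int_pow_int)
  then have "commutator h (y [^] i) = \<one>" using y(1) hc by (simp add: commutator_eq_one_iff)
  \<comment> \<open>The power of \<open>y\<close> drops out because \<open>h\<close> lies in
    \<open>M\<close>; the remaining commutator with \<open>s \<in> ?Z2\<close> is central, unlike
    \<open>x\<close>.\<close>
  then have "commutator h w = commutator h s"
    unfolding s(2) using y(1) hc sc by (simp add: commutator_mult_right)
  then have "x \<in> ?Z1" using hw Z2comm(2)[OF s(1) hc] by simp
  with x(2) show False by blast
qed

end

section \<open>Case distinction on the nilpotency class\<close>

theorem theorem2p5:
  fixes G :: "('a, 'b) monoid_scheme" and p n :: nat
  assumes "Factorial_Ring.prime p" and "p > 2"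
    and "group G" and "order G = p ^ n" and "coclass p G = 2"
  shows "\<exists>\<alpha> \<in> auto G. \<alpha> \<notin> inner_auto G \<and> group.ord (AutoGroup G) \<alpha> = p \<and>
    (n \<ge> 7 \<longrightarrow>
      (\<forall>x \<in> frattini G. \<alpha> x = x) \<or> (\<forall>x \<in> upper_central G (n - 4). \<alpha> x = x))"
proof -
  interpret group G by fact
  interpret finite_p_group G p n using assms by unfold_locales
  have odd: "odd p" using assms(1,2) prime_odd_nat by simp
  let ?c = "nilpotency_class G"
  have "multiplicity p (order G) = n"
    using assms(1,4) by (simp add: prime_elem_multiplicity_power_distrib)
  then have n: "n = ?c + 2" using assms(5) by (simp add: coclass_def)
  have "?c = 0 \<or> ?c = 1 \<or> ?c = 2 \<or> ?c = (?c - 3) + 3" by arith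
  then consider "?c = 0" | "?c = 1" | "?c = 2" | k where "?c = k + 3" by metis
  then show ?thesis
  proof cases
    \<comment> \<open>Class 0 means a trivial group, against \<open>n = 2\<close>.\<close>
    case 1
    then have "carrier G = {\<one>\<^bsub>G\<^esub>}" using upper_central_nilpotency_class by simp
    then have "p ^ 2 = 1" using assms(4) n 1 by (simp add: order_def)
    then show ?thesis using assms(2) by simp
  next
    case 2
    then have "upper_central G (Suc 0) = carrier G" using upper_central_nilpotency_class by simp
    then show ?thesis using noninner_auto_abelian[OF odd] n by auto
  next
    case 3
    then have "upper_central G (Suc (Suc 0)) = carrier G"
      using upper_central_nilpotency_class by (simp add: numeral_2_eq_2)
    moreover have "upper_central G (Suc 0) \<noteq> carrier G" using upper_central_less_class[of 1] 3 by simp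
    ultimately show ?thesis using noninner_auto_class2[OF odd] n 3 by auto
  next
    case 4
    moreover have "n = k + 5" using n 4 by simp
    moreover have "n - 4 = Suc k" using n 4 by simp
    ultimately show ?thesis using noninner_auto_large_class[OF odd] by auto
  qed
qed

end
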